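(* Let $G$ be a finite simple connected graph with clique number $\omega(G)$. For every integer $r\ge 1$, \[\lambda_1^r(G) \le \sum_{v\in V(G)} w_r(v)\sqrt{1-\frac{1}{c(v)}}\sqrt{1-\frac{1}{\omega(G)}}.\] Moreover, equality holds if and only if: when $\omega>2$, $G$ is a regular complete $\omega$-partite graph; when $\omega=2$, $G$ is a complete bipartite graph, which in addition is regular if $r$ is odd.
   Context: $\lambda_1(G)$ is the largest eigenvalue of the adjacency matrix of $G$. For a vertex $v$, $c(v)$ is the order of the largest clique of $G$ containing $v$, and $w_r(v)$ is the number of walks with $r$ vertices (i.e. of length $r-1$) in $G$ starting at $v$. *)

theory Defs
  imports Complex_Main
    "HOL-Library.Disjoint_Sets"
    "Graph_Theory.Graph_Theory"
    "Jordan_Normal_Form.Spectral_Radius"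
begin

text \<open>
  Finite simple graphs are the symmetric, loop-free digraphs without parallel arcs
  described by the locale \<^locale>\<open>graph\<close>: an undirected edge between
  \<open>u\<close> and \<open>v\<close> is represented by the two arcs \<open>(u, v)\<close> and \<open>(v, u)\<close>.
\<close>

definition adjacency_mat :: "('a, 'b) pre_digraph \<Rightarrow> 'a list \<Rightarrow> real mat" where
  "adjacency_mat G vs =
     mat (length vs) (length vs) (\<lambda>(i, j). if vs ! i \<rightarrow>\<^bsub>G\<^esub> vs ! j then 1 else 0)"

text \<open>
  Matrices are indexed by natural numbers, so the adjacency matrix depends on an enumeration
  of the vertices. Its spectrum does not, see \<open>spectrum_adjacency_mat\<close> below.
\<close>

definition lambda1 :: "('a, 'b) pre_digraph \<Rightarrow> real" where
  "lambda1 G =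
     Max (spectrum (adjacency_mat G (SOME vs. distinct vs \<and> set vs = verts G)))"

definition clique :: "('a, 'b) pre_digraph \<Rightarrow> 'a set \<Rightarrow> bool" where
  "clique G S \<longleftrightarrow> S \<subseteq> verts G \<and> (\<forall>u\<in>S. \<forall>v\<in>S. u \<noteq> v \<longrightarrow> u \<rightarrow>\<^bsub>G\<^esub> v)"

definition clique_number :: "('a, 'b) pre_digraph \<Rightarrow> nat" where
  "clique_number G = Max {card S |S. clique G S}"

definition clique_number_at :: "('a, 'b) pre_digraph \<Rightarrow> 'a \<Rightarrow> nat" where
  "clique_number_at G v = Max {card S |S. clique G S \<and> v \<in> S}"

text \<open>The parameter \<open>r\<close> is the number of vertices of the walk, not its length.\<close>

definition num_walks :: "('a, 'b) pre_digraph \<Rightarrow> nat \<Rightarrow> 'a \<Rightarrow> nat" where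
  "num_walks G r v = card {p. vwalk p G \<and> length p = r \<and> hd p = v}"

definition complete_multipartite :: "nat \<Rightarrow> ('a, 'b) pre_digraph \<Rightarrow> bool" where
  "complete_multipartite k G \<longleftrightarrow>
     (\<exists>P. partition_on (verts G) P \<and> card P = k \<and>
        (\<forall>u\<in>verts G. \<forall>v\<in>verts G. u \<rightarrow>\<^bsub>G\<^esub> v \<longleftrightarrow> \<not> (\<exists>X\<in>P. u \<in> X \<and> v \<in> X)))"

definition regular :: "('a, 'b) pre_digraph \<Rightarrow> bool" where
  "regular G \<longleftrightarrow> (\<exists>d. \<forall>v\<in>verts G. out_degree G v = d)"

lemma eigenvalue_adjacency_mat:
  assumes "distinct vs" "set vs = V"
  shows "eigenvalue (adjacency_mat G vs) k \<longleftrightarrow>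
    (\<exists>x. (\<exists>v\<in>V. x v \<noteq> 0) \<and> (\<forall>u\<in>V. (\<Sum>v\<in>V. if u \<rightarrow>\<^bsub>G\<^esub> v then x v else 0) = k * x u))"
    (is "?L \<longleftrightarrow> ?R")
proof -
  define n where "n = length vs"
  let ?A = "adjacency_mat G vs"
  have bij: "bij_betw (\<lambda>i. vs ! i) {0..<n} V"
    using bij_betw_nth[OF assms(1), of "{0..<n}" V] assms(2)
    by (simp add: n_def atLeast0LessThan)
  have mv: "(?A *\<^sub>v vec n (\<lambda>i. x (vs ! i))) $ i
      = (\<Sum>v\<in>V. if vs ! i \<rightarrow>\<^bsub>G\<^esub> v then x v else 0)" if "i < n" for x i
  proof -
    have "(?A *\<^sub>v vec n (\<lambda>i. x (vs ! i))) $ i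
        = (\<Sum>j\<in>{0..<n}. if vs ! i \<rightarrow>\<^bsub>G\<^esub> vs ! j then x (vs ! j) else 0)"
      using that by (auto simp: adjacency_mat_def n_def scalar_prod_def intro!: sum.cong)
    also have "\<dots> = (\<Sum>v\<in>V. if vs ! i \<rightarrow>\<^bsub>G\<^esub> v then x v else 0)"
      by (rule sum.reindex_bij_betw[OF bij])
    finally show ?thesis .
  qed
  have dim: "dim_row ?A = n" "dim_col ?A = n"
    by (auto simp: adjacency_mat_def n_def)
  have all: "(\<forall>v\<in>V. Q v) \<longleftrightarrow> (\<forall>i<n. Q (vs ! i))" for Q
    unfolding assms(2)[symmetric] n_def by (rule all_set_conv_all_nth)
  have key: "eigenvector ?A (vec n (\<lambda>i. x (vs ! i))) k \<longleftrightarrow>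
      (\<exists>v\<in>V. x v \<noteq> 0) \<and> (\<forall>u\<in>V. (\<Sum>v\<in>V. if u \<rightarrow>\<^bsub>G\<^esub> v then x v else 0) = k * x u)" for x
  proof -
    have "vec n (\<lambda>i. x (vs ! i)) = 0\<^sub>v n \<longleftrightarrow> (\<forall>v\<in>V. x v = 0)"
      unfolding all by (auto simp: vec_eq_iff)
    moreover have "?A *\<^sub>v vec n (\<lambda>i. x (vs ! i)) = k \<cdot>\<^sub>v vec n (\<lambda>i. x (vs ! i)) \<longleftrightarrow>
        (\<forall>u\<in>V. (\<Sum>v\<in>V. if u \<rightarrow>\<^bsub>G\<^esub> v then x v else 0) = k * x u)"
      unfolding all vec_eq_iff using mv dim by auto
    ultimately show ?thesis
      unfolding eigenvector_def dim by auto
  qed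
  show ?thesis
  proof
    assume ?L
    then obtain w where w: "eigenvector ?A w k" by (auto simp: eigenvalue_def)
    define x where "x v = w $ (the_inv_into {0..<n} (\<lambda>i. vs ! i) v)" for v
    have "x (vs ! i) = w $ i" if "i < n" for i
      using bij that by (auto simp: x_def bij_betw_def the_inv_into_f_f)
    then have "vec n (\<lambda>i. x (vs ! i)) = w"
      using w by (intro eq_vecI) (auto simp: eigenvector_def dim)
    then show ?R using key[of x] w by auto
  next
    assume ?R
    then show ?L using key by (auto simp: eigenvalue_def)
  qed
qed

lemma spectrum_adjacency_mat:
  assumes "distinct vs" "distinct ws" "set vs = set ws"
  shows "spectrum (adjacency_mat G vs) = spectrum (adjacency_mat G ws)"
  unfolding spectrum_def
  using eigenvalue_adjacency_mat[OF assms(1) refl, of G]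
    eigenvalue_adjacency_mat[OF assms(2) refl, of G] assms(3)
  by (auto simp: set_eq_iff)

end

theory Submission
  imports Defs "HOL-Analysis.Convex"
begin

text \<open>
  Write \<open>A\<close> for the adjacency operator, \<open>W m\<close> for the number of walks with \<open>m\<close> vertices,
  \<open>a = 1 - 1 / \<omega>\<close> and \<open>g v = sqrt (1 - 1 / c v)\<close>. A weighted Motzkin-Straus inequality gives
  \<open>y \<bullet> A y \<le> (\<Sum>v. g v * y v)\<^sup>2\<close> for all \<open>y \<ge> 0\<close>, and also \<open>y \<bullet> A y \<le> a * (\<Sum>v. y v)\<^sup>2\<close>.
  Applied to \<open>y = w m\<close>, where \<open>y \<bullet> A y = W (2 * m)\<close>, the second one yields
  \<open>\<lambda> ^ m \<le> a * W m\<close> after iterated doubling, so by the first one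
  \<open>\<lambda> ^ (2 * r) \<le> a * W (2 * r) \<le> a * (\<Sum>v. g v * w r v)\<^sup>2\<close>.

  In case of equality the positive vector \<open>y = w (2 * r)\<close> is an interior maximiser of \<open>y \<bullet> A y\<close> for
  its total weight. The first and second order conditions make \<open>A y\<close> constant and
  non-adjacency transitive, so the graph is complete multipartite with parts of equal weight;
  with three or more parts this forces the parts to have equal size.
\<close>

section \<open>Elementary estimates: iterated powers, small perturbations, quadratics near
  zero\<close>

text \<open>If \<open>b < c\<close>, then \<open>(b / c) ^ n\<close> tends to 0, while the
  hypothesis keeps \<open>m * (b / c) ^ 2 ^ j\<close> at least \<open>a\<close>. This strips the
  constants from estimates obtained by repeated doubling, where only exponents \<open>2 ^ j\<close>
  are available.\<close>

lemma le_of_power_of_two_bounds: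
  fixes a b c m :: real
  assumes "0 < a" "0 \<le> b" "0 \<le> m"
    and bound: "\<And>j. a * c ^ 2 ^ j \<le> m * b ^ 2 ^ j"
  shows "c \<le> b"
proof (rule ccontr)
  assume "\<not> c \<le> b"
  then have "b < c" "0 < c" using assms by auto
  define q where "q = b / c"
  have q: "0 \<le> q" "q < 1" using \<open>b < c\<close> \<open>0 < c\<close> assms by (auto simp: q_def)
  have "(\<lambda>n. m * q ^ n) \<longlonglongrightarrow> m * 0"
    using q by (intro tendsto_intros LIMSEQ_power_zero) auto
  then have "\<forall>\<^sub>F n in sequentially. m * q ^ n < a"
    using \<open>0 < a\<close> by (intro order_tendstoD) auto
  then obtain N where N: "m * q ^ N < a" by (auto simp: eventually_sequentially)
  have "a \<le> m * q ^ 2 ^ N"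
    using bound[of N] \<open>0 < c\<close> by (simp add: q_def power_divide field_simps)
  \<comment> \<open>Since \<open>N < 2 ^ N\<close> and \<open>0 \<le> q < 1\<close>, the exponent
    may be lowered to \<open>N\<close>.\<close>
  also have "\<dots> \<le> m * q ^ N"
    using q assms by (intro mult_left_mono power_decreasing) (auto intro: less_imp_le less_exp)
  finally show False using N by simp
qed

text \<open>Finitely many strict inequalities survive a small change of \<open>t\<close>. Both signs
  of \<open>t\<close> are allowed, as two-sided optimality conditions require.\<close>

lemma positive_perturbation:
  fixes x d :: "'a \<Rightarrow> real"
  assumes "finite V" "\<And>v. v \<in> V \<Longrightarrow> 0 < x v"
  shows "\<exists>e>0. \<forall>t. \<bar>t\<bar> < e \<longrightarrow> (\<forall>v\<in>V. 0 \<le> x v + t * d v)"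
proof -
  have "\<forall>\<^sub>F t in at 0. 0 < x v + t * d v" if "v \<in> V" for v
  proof -
    have "((\<lambda>t. x v + t * d v) \<longlongrightarrow> x v + 0 * d v) (at 0)" by (intro tendsto_intros)
    then show ?thesis using assms(2)[OF that] by (intro order_tendstoD) auto
  qed
  then have "\<forall>\<^sub>F t in at 0. \<forall>v\<in>V. 0 < x v + t * d v"
    using assms(1) by (simp add: eventually_ball_finite)
  then obtain e where e: "e > 0" "\<And>t. t \<noteq> 0 \<Longrightarrow> \<bar>t\<bar> < e \<Longrightarrow> \<forall>v\<in>V. 0 < x v + t * d v"
    unfolding eventually_at by (auto simp: dist_real_def)
  have "\<forall>v\<in>V. 0 \<le> x v + t * d v" if "\<bar>t\<bar> < e" for t
    using e(2)[of t] that assms(2) by (cases "t = 0") (auto intro: less_imp_le)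
  then show ?thesis using e(1) by blast
qed

text \<open>First and second order conditions at a local maximum: adding the bounds for
  \<open>t\<close> and \<open>- t\<close> cancels the linear term, and for small \<open>t\<close>
  the linear term would dominate the quadratic one.\<close>

lemma quadratic_nonpos_near_zero:
  fixes p q :: real
  assumes "0 < e" and le: "\<And>t. \<bar>t\<bar> < e \<Longrightarrow> 2 * t * p + t\<^sup>2 * q \<le> 0"
  shows "p = 0 \<and> q \<le> 0"
proof -
  define h where "h = e / 2"
  have h: "0 < h" "h < e" using assms by (auto simp: h_def)
  have "h\<^sup>2 * q \<le> 0" using le[of h] le[of "-h"] h by simp
  then have q: "q \<le> 0" using h by (simp add: mult_le_0_iff)
  have "p = 0"
  proof (rule ccontr)
    assume "p \<noteq> 0"
    \<comment> \<open>Small enough that \<open>s * \<bar>q\<bar> < 2 * \<bar>p\<bar>\<close>; the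
      bounds at \<open>s\<close> and \<open>- s\<close> force the opposite inequality.\<close>
    define s where "s = min h (\<bar>p\<bar> / (1 + \<bar>q\<bar>))"
    have s: "0 < s" "s < e" using h \<open>p \<noteq> 0\<close> by (auto simp: s_def)
    have "s \<le> \<bar>p\<bar> / (1 + \<bar>q\<bar>)" by (simp add: s_def)
    then have "s * (1 + \<bar>q\<bar>) \<le> \<bar>p\<bar>" by (simp add: pos_le_divide_eq)
    then have "s * \<bar>q\<bar> < 2 * \<bar>p\<bar>" using s by (simp add: algebra_simps)
    moreover have "2 * \<bar>p\<bar> \<le> s * \<bar>q\<bar>"
    proof -
      have "s * (2 * p + s * q) \<le> 0" "s * (- 2 * p + s * q) \<le> 0"
        using le[of s] le[of "-s"] s by (auto simp: algebra_simps power2_eq_square)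
      then have "2 * p + s * q \<le> 0" "- 2 * p + s * q \<le> 0"
        using s by (auto simp: mult_le_0_iff)
      then show ?thesis using q by (auto simp: abs_if)
    qed
    ultimately show False by simp
  qed
  with q show ?thesis by simp
qed

section \<open>The adjacency operator, its quadratic form and the weighted Motzkin-Straus
  inequality\<close>

text \<open>Vectors are functions on \<open>V\<close>, so eigenvector equations and walk counts need
  no enumeration of the vertices.\<close>

locale finite_adjacency =
  fixes V :: "'a set" and E :: "'a \<Rightarrow> 'a \<Rightarrow> bool"
  assumes fin: "finite V"
    and sym: "E u v \<Longrightarrow> E v u"
    and irrefl: "\<not> E u u"
begin

text \<open>\<open>nbr x\<close> is the vector \<open>A x\<close> for the adjacency matrix
  \<open>A\<close> of the graph on \<open>V\<close>.\<close>

definition nbr :: "('a \<Rightarrow> real) \<Rightarrow> 'a \<Rightarrow> real" where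
  "nbr x u = (\<Sum>v\<in>V. if E u v then x v else 0)"

text \<open>The symmetric bilinear form \<open>x \<bullet> A y\<close>.\<close>

definition adj_form :: "('a \<Rightarrow> real) \<Rightarrow> ('a \<Rightarrow> real) \<Rightarrow> real" where
  "adj_form x y = (\<Sum>u\<in>V. x u * nbr y u)"

text \<open>\<open>walks k v\<close> counts the walks from \<open>v\<close> of length \<open>k\<close>, whereas \<open>tot r\<close> counts by the number
  \<open>r \<ge> 1\<close> of vertices.\<close>

primrec walks :: "nat \<Rightarrow> 'a \<Rightarrow> real" where
  "walks 0 = (\<lambda>v. 1)"
| "walks (Suc k) = nbr (walks k)"

definition tot :: "nat \<Rightarrow> real" where
  "tot r = (\<Sum>v\<in>V. walks (r - 1) v)"

lemma nbr_cong: "(\<And>v. v \<in> V \<Longrightarrow> x v = y v) \<Longrightarrow> nbr x u = nbr y u"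
  unfolding nbr_def by (intro sum.cong) auto

lemma nbr_add_scaled: "nbr (\<lambda>v. x v + t * y v) u = nbr x u + t * nbr y u"
proof -
  have "nbr (\<lambda>v. x v + t * y v) u
      = (\<Sum>v\<in>V. (if E u v then x v else 0) + t * (if E u v then y v else 0))"
    unfolding nbr_def by (intro sum.cong) auto
  then show ?thesis by (simp add: nbr_def sum.distrib sum_distrib_left)
qed

lemma nbr_scaled: "nbr (\<lambda>v. t * x v) u = t * nbr x u"
  using nbr_add_scaled[of "\<lambda>_. 0" t x u] by (simp add: nbr_def)

lemma nbr_mono: "(\<And>v. v \<in> V \<Longrightarrow> x v \<le> y v) \<Longrightarrow> nbr x u \<le> nbr y u"
  unfolding nbr_def by (intro sum_mono) auto

lemma abs_nbr_le: "\<bar>nbr x u\<bar> \<le> nbr (\<lambda>v. \<bar>x v\<bar>) u"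
  unfolding nbr_def by (rule order_trans[OF sum_abs]) (intro sum_mono, auto)

lemma nbr_nonneg: "(\<And>v. v \<in> V \<Longrightarrow> 0 \<le> x v) \<Longrightarrow> 0 \<le> nbr x u"
  unfolding nbr_def by (intro sum_nonneg) auto

lemma nbr_const: "nbr (\<lambda>_. c) u = c * card {v\<in>V. E u v}"
  using fin by (simp add: nbr_def sum.If_cases Int_def)

text \<open>Suited to complete multipartite graphs, where the subtracted sum is the weight of the
  part of \<open>u\<close>.\<close>

lemma nbr_eq_diff: "nbr x u = sum x V - sum x {v\<in>V. \<not> E u v}"
proof -
  have "sum x V = sum x {v\<in>V. E u v} + sum x {v\<in>V. \<not> E u v}"
    using fin by (subst sum.union_disjoint[symmetric]) (auto intro: sum.cong)
  moreover have "nbr x u = sum x {v\<in>V. E u v}"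
    using fin by (simp add: nbr_def sum.If_cases Int_def)
  ultimately show ?thesis by simp
qed

lemma nbr_indicator:
  assumes "w \<in> V"
  shows "nbr (\<lambda>v. of_bool (v = w)) u = of_bool (E u w)"
proof -
  have "nbr (\<lambda>v. of_bool (v = w)) u = (\<Sum>v\<in>V. if v = w then of_bool (E u w) else 0)"
    unfolding nbr_def by (intro sum.cong) auto
  then show ?thesis using assms fin by simp
qed

lemma adj_form_commute: "adj_form x y = adj_form y x"
proof -
  have "adj_form x y = (\<Sum>u\<in>V. \<Sum>v\<in>V. if E u v then x u * y v else 0)"
    unfolding adj_form_def nbr_def sum_distrib_left by (intro sum.cong) auto
  also have "\<dots> = (\<Sum>v\<in>V. \<Sum>u\<in>V. if E u v then x u * y v else 0)"
    by (rule sum.swap)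
  also have "\<dots> = adj_form y x"
    unfolding adj_form_def nbr_def sum_distrib_left
    by (intro sum.cong) (auto dest: sym)
  finally show ?thesis .
qed

lemma adj_form_perturb:
  "adj_form (\<lambda>v. x v + t * d v) (\<lambda>v. x v + t * d v)
    = adj_form x x + 2 * t * adj_form d x + t\<^sup>2 * adj_form d d"
proof -
  have "adj_form (\<lambda>v. x v + t * d v) (\<lambda>v. x v + t * d v)
    = adj_form x x + t * adj_form x d + t * adj_form d x + t\<^sup>2 * adj_form d d"
    unfolding adj_form_def nbr_add_scaled
    by (simp add: algebra_simps sum.distrib sum_distrib_left power2_eq_square)
  then show ?thesis by (simp add: adj_form_commute[of x d])
qed

lemma adj_form_indicators2:
  assumes "u \<in> V" "v \<in> V"
  shows "adj_form (\<lambda>x. a * of_bool (x = u) + b * of_bool (x = v)) y = a * nbr y u + b * nbr y v"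
  using assms fin
  by (simp add: adj_form_def distrib_right sum.distrib mult.assoc sum_distrib_left[symmetric]
      of_bool_def if_distrib[of "\<lambda>c. c * _"] cong: if_cong)

text \<open>Moving weight between two non-adjacent vertices along a direction that keeps the weighted
  total fixed changes the form linearly, so one of them can be emptied without decreasing the
  form; this reduces to the case where the support is a clique.\<close>

lemma weighted_motzkin_straus:
  fixes g y :: "'a \<Rightarrow> real"
  assumes g: "\<And>v. v \<in> V \<Longrightarrow> 0 < g v"
    and clique: "\<And>K v. K \<subseteq> V \<Longrightarrow> pairwise E K \<Longrightarrow> v \<in> K \<Longrightarrow> 1 - 1 / card K \<le> (g v)\<^sup>2"
    and y: "\<And>v. v \<in> V \<Longrightarrow> 0 \<le> y v"
  shows "adj_form y y \<le> (\<Sum>v\<in>V. g v * y v)\<^sup>2"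
  using y
proof (induction "card {v\<in>V. y v \<noteq> 0}" arbitrary: y rule: less_induct)
  case less
  define S where "S = {v\<in>V. y v \<noteq> 0}"
  have S: "S \<subseteq> V" "finite S" using fin by (auto simp: S_def)
  show ?case
  proof (cases "pairwise E S")
    case True
    define c where "c = sqrt (1 - 1 / card S)"
    have sumS: "sum f S = sum f V" if "\<And>v. v \<in> V \<Longrightarrow> y v = 0 \<Longrightarrow> f v = 0" for f :: "'a \<Rightarrow> real"
      using that S fin by (intro sum.mono_neutral_left) (auto simp: S_def)
    \<comment> \<open>On a clique the adjacency matrix is the all-ones matrix minus the
      identity.\<close>
    have "nbr y u = sum y S - y u" if "u \<in> S" for u
    proof -
      have "nbr y u = (\<Sum>v\<in>S. if E u v then y v else 0)"
        unfolding nbr_def by (rule sumS[symmetric]) auto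
      also have "\<dots> = (\<Sum>v\<in>S. y v - (if v = u then y u else 0))"
        using True that irrefl by (intro sum.cong) (auto simp: pairwise_def)
      also have "\<dots> = sum y S - y u" using that S by (simp add: sum_subtractf)
      finally show ?thesis .
    qed
    then have "adj_form y y = (\<Sum>u\<in>S. y u * (sum y S - y u))"
      unfolding adj_form_def by (subst sumS[symmetric]) auto
    also have "\<dots> = (sum y S)\<^sup>2 - (\<Sum>u\<in>S. (y u)\<^sup>2)"
      by (simp add: right_diff_distrib sum_subtractf power2_eq_square sum_distrib_right)
    \<comment> \<open>Cauchy-Schwarz on \<open>S\<close> bounds the sum of squares from below by
      \<open>(sum y S)\<^sup>2 / card S\<close>.\<close>
    also have "\<dots> \<le> (c * sum y S)\<^sup>2"
    proof (cases "S = {}")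
      case False
      then have "card S > 0" using S by (simp add: card_gt_0_iff)
      then have "c\<^sup>2 = 1 - 1 / card S" by (simp add: c_def)
      moreover have "(sum y S)\<^sup>2 \<le> (\<Sum>u\<in>S. (y u)\<^sup>2) * card S"
        by (rule sum_squared_le_sum_of_squares)
      then have "(sum y S)\<^sup>2 / card S \<le> (\<Sum>u\<in>S. (y u)\<^sup>2)"
        using \<open>card S > 0\<close> by (simp add: field_simps)
      ultimately show ?thesis
        by (simp add: power_mult_distrib left_diff_distrib)
    qed simp
    also have "\<dots> \<le> (\<Sum>v\<in>S. g v * y v)\<^sup>2"
    proof (rule power_mono)
      show "c * sum y S \<le> (\<Sum>v\<in>S. g v * y v)"
        unfolding sum_distrib_left
      proof (intro sum_mono mult_right_mono)
        fix v assume "v \<in> S"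
        then show "0 \<le> y v" using less.prems S by auto
        have "1 - 1 / card S \<le> (g v)\<^sup>2" using clique[OF S(1) True \<open>v \<in> S\<close>] .
        then show "c \<le> g v"
          unfolding c_def using g[of v] \<open>v \<in> S\<close> S(1) by (intro real_le_lsqrt) auto
      qed
      \<comment> \<open>For an empty support, \<open>1 / 0 = 0\<close> gives
        \<open>c = 1\<close>.\<close>
      have "0 \<le> c"
      proof (cases "card S")
        case (Suc n)
        then show ?thesis by (simp add: c_def)
      qed (simp add: c_def)
      then show "0 \<le> c * sum y S"
        using less.prems S by (intro mult_nonneg_nonneg sum_nonneg) auto
    qed
    also have "(\<Sum>v\<in>S. g v * y v) = (\<Sum>v\<in>V. g v * y v)" by (rule sumS) auto
    finally show ?thesis .
  next
    case False
    then obtain u v where uv: "u \<in> S" "v \<in> S" "u \<noteq> v" "\<not> E u v"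
      by (auto simp: pairwise_def)
    then have uvV: "u \<in> V" "v \<in> V" using S by auto
    have yuv: "0 < y u" "0 < y v" "0 < g u" "0 < g v"
      using uv less.prems g uvV by (auto simp: S_def order_less_le)
    \<comment> \<open>The coefficients \<open>g v\<close> and \<open>- g u\<close> keep the
      \<open>g\<close>-weighted total constant, and \<open>adj_form d d = 0\<close> because
      \<open>u\<close> and \<open>v\<close> are non-adjacent.\<close>
    define d where "d x = g v * of_bool (x = u) + (- g u) * of_bool (x = v)" for x
    have dform: "adj_form d z = g v * nbr z u - g u * nbr z v" for z
      unfolding d_def adj_form_indicators2[OF uvV] by simp
    have "nbr d w = g v * of_bool (E w u) - g u * of_bool (E w v)" for w
      unfolding d_def nbr_add_scaled using nbr_scaled[of "g v" "\<lambda>x. of_bool (x = u)" w] uvV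
      by (simp add: nbr_indicator)
    then have dd: "adj_form d d = 0"
      using uv irrefl sym[of v u] by (auto simp: dform)
    have gd: "(\<Sum>w\<in>V. g w * d w) = 0"
      using fin uvV by (simp add: d_def distrib_left right_diff_distrib sum.distrib sum_subtractf of_bool_def
          if_distrib[of "\<lambda>c. _ * c"] cong: if_cong)
    \<comment> \<open>The sign of \<open>t\<close> makes \<open>t * adj_form d y\<close>
      nonnegative; its size makes \<open>z\<close> vanish at \<open>v\<close> in the first case and
      at \<open>u\<close> in the second, so the support shrinks.\<close>
    define t where "t = (if 0 \<le> adj_form d y then y v / g u else - (y u / g v))"
    define z where "z w = y w + t * d w" for w
    have "- (y u * g u / g v) \<le> 0" using yuv by simp
    also have "\<dots> \<le> y v" using yuv by simp
    finally have z: "0 \<le> z w" if "w \<in> V" for w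
      using less.prems[OF that] yuv uv(3) by (auto simp: z_def d_def t_def)
    have "\<exists>w\<in>{u, v}. z w = 0"
      using yuv uv(3) by (auto simp: z_def d_def t_def)
    moreover have "z w = y w" if "w \<notin> {u, v}" for w using that by (auto simp: z_def d_def)
    ultimately have "{w\<in>V. z w \<noteq> 0} \<subset> S"
      using uv uvV by (fastforce simp: S_def)
    then have "card {w\<in>V. z w \<noteq> 0} < card S" using S by (intro psubset_card_mono)
    then have IH: "adj_form z z \<le> (\<Sum>w\<in>V. g w * z w)\<^sup>2"
      using less.hyps[of z] z unfolding S_def by blast
    have "0 \<le> t \<and> 0 \<le> adj_form d y \<or> t \<le> 0 \<and> adj_form d y \<le> 0"
      using yuv by (auto simp: t_def)
    then have "0 \<le> t * adj_form d y" by (simp add: zero_le_mult_iff)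
    then have "adj_form y y \<le> adj_form z z"
      unfolding z_def adj_form_perturb dd by simp
    also have "\<dots> \<le> (\<Sum>w\<in>V. g w * z w)\<^sup>2" by (rule IH)
    also have "(\<Sum>w\<in>V. g w * z w) = (\<Sum>w\<in>V. g w * y w) + t * (\<Sum>w\<in>V. g w * d w)"
      by (simp add: z_def algebra_simps sum.distrib sum_distrib_left)
    finally show ?thesis using gd by simp
  qed
qed

section \<open>Optimality conditions at a positive maximiser of the form\<close>

text \<open>Along a direction of total weight zero, \<open>x + t * d\<close> stays nonnegative and
  keeps its total for all small \<open>t\<close> of either sign, so the quadratic of
  \<open>adj_form_perturb\<close> has a local maximum at \<open>t = 0\<close>.\<close>

lemma interior_maximizer_critical:
  assumes x: "\<And>v. v \<in> V \<Longrightarrow> 0 < x v"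
    and eq: "adj_form x x = a * (sum x V)\<^sup>2"
    and le: "\<And>y. (\<And>v. v \<in> V \<Longrightarrow> 0 \<le> y v) \<Longrightarrow> adj_form y y \<le> a * (sum y V)\<^sup>2"
    and d: "sum d V = 0"
  shows "adj_form d x = 0 \<and> adj_form d d \<le> 0"
proof -
  obtain e where e: "e > 0" "\<And>t. \<bar>t\<bar> < e \<Longrightarrow> \<forall>v\<in>V. 0 \<le> x v + t * d v"
    using positive_perturbation[where V = V and x = x and d = d, OF fin x] by blast
  have "2 * t * adj_form d x + t\<^sup>2 * adj_form d d \<le> 0" if "\<bar>t\<bar> < e" for t
  proof -
    have "adj_form x x + 2 * t * adj_form d x + t\<^sup>2 * adj_form d d \<le> a * (\<Sum>v\<in>V. x v + t * d v)\<^sup>2"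
      using e(2)[OF that] le[of "\<lambda>v. x v + t * d v"] by (simp add: adj_form_perturb)
    also have "(\<Sum>v\<in>V. x v + t * d v) = sum x V"
      using d by (simp add: sum.distrib sum_distrib_left[symmetric])
    finally show ?thesis using eq by simp
  qed
  then show ?thesis using quadratic_nonpos_near_zero[OF e(1)] by blast
qed

text \<open>The first order condition in the direction moving weight from \<open>v\<close> to
  \<open>u\<close> gives the first claim. For the second, the direction with entries 1 at
  \<open>u\<close> and \<open>w\<close> and -2 at \<open>v\<close> has
  \<open>adj_form d d = 2\<close> if \<open>u\<close> and \<open>w\<close> are adjacent and neither
  is adjacent to \<open>v\<close>, against the second order condition.\<close>

lemma interior_maximizer_structure:
  assumes x: "\<And>v. v \<in> V \<Longrightarrow> 0 < x v"
    and eq: "adj_form x x = a * (sum x V)\<^sup>2"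
    and le: "\<And>y. (\<And>v. v \<in> V \<Longrightarrow> 0 \<le> y v) \<Longrightarrow> adj_form y y \<le> a * (sum y V)\<^sup>2"
  shows "\<And>u v. u \<in> V \<Longrightarrow> v \<in> V \<Longrightarrow> nbr x u = nbr x v"
    and "\<And>u v w. u \<in> V \<Longrightarrow> v \<in> V \<Longrightarrow> w \<in> V \<Longrightarrow> \<not> E u v \<Longrightarrow> \<not> E v w \<Longrightarrow> \<not> E u w"
proof -
  note crit = interior_maximizer_critical[of x a, OF x eq le]
  show "nbr x u = nbr x v" if "u \<in> V" "v \<in> V" for u v
  proof -
    have "(\<Sum>w\<in>V. 1 * of_bool (w = u) + (-1) * of_bool (w = v) :: real) = 0"
      using that fin by (simp add: sum_subtractf of_bool_def)
    from crit[OF _ _ this] show ?thesis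
      unfolding adj_form_indicators2[OF that] by simp
  qed
  show "\<not> E u w" if "u \<in> V" "v \<in> V" "w \<in> V" "\<not> E u v" "\<not> E v w" for u v w
  proof
    assume "E u w"
    define d :: "'a \<Rightarrow> real" where
      "d z = (1 * of_bool (z = u) + 1 * of_bool (z = w)) + (-2) * of_bool (z = v)" for z
    have nE: "\<not> E v u" "\<not> E w v" "E w u" using that sym \<open>E u w\<close> by blast+
    have sd: "sum d V = 0"
      using that fin by (simp add: d_def sum_subtractf sum.distrib sum_distrib_left[symmetric] of_bool_def)
    have nd: "nbr d z = of_bool (E z u) + of_bool (E z w) - 2 * of_bool (E z v)" for z
      unfolding d_def nbr_add_scaled
      using nbr_add_scaled[of "\<lambda>z. of_bool (z = u)" 1 "\<lambda>z. of_bool (z = w)" z] that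
      by (simp add: nbr_indicator)
    have "adj_form d d = nbr d u + nbr d w - 2 * nbr d v"
      using that fin
      by (simp add: adj_form_def d_def[abs_def] left_diff_distrib distrib_right sum.distrib
          sum_subtractf mult.assoc sum_distrib_left[symmetric]
          of_bool_def if_distrib[of "\<lambda>c. c * _"] cong: if_cong)
    also have "\<dots> = 2"
      unfolding nd using that nE \<open>E u w\<close> irrefl by simp
    finally show False using crit[OF _ _ sd] by simp
  qed
qed

section \<open>Walk counts and eigenvalue bounds\<close>

lemma walks_nonneg: "0 \<le> walks k v"
  by (induction k arbitrary: v) (auto intro: nbr_nonneg)

lemma walks_pos:
  assumes "\<And>v. v \<in> V \<Longrightarrow> \<exists>u\<in>V. E v u" "v \<in> V"
  shows "0 < walks k v"
  using assms(2)
proof (induction k arbitrary: v)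
  case (Suc k)
  obtain u where u: "u \<in> V" "E v u" using assms(1) Suc.prems by blast
  have "0 < (if E v u then walks k u else 0)" using Suc.IH u by simp
  also have "\<dots> \<le> nbr (walks k) v"
    unfolding nbr_def using u fin walks_nonneg by (intro member_le_sum) auto
  finally show ?case by simp
qed simp

text \<open>Self-adjointness moves one step from the first factor to the second, so the scalar
  product depends only on \<open>i + j\<close>.\<close>

lemma sum_walks_mult: "(\<Sum>v\<in>V. walks i v * walks j v) = (\<Sum>v\<in>V. walks (i + j) v)"
proof (induction i arbitrary: j)
  case (Suc i)
  have "(\<Sum>v\<in>V. walks (Suc i) v * walks j v) = adj_form (walks j) (walks i)"
    by (simp add: adj_form_def mult.commute)
  also have "\<dots> = (\<Sum>v\<in>V. walks i v * walks (Suc j) v)"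
    by (subst adj_form_commute) (simp add: adj_form_def)
  also have "\<dots> = (\<Sum>v\<in>V. walks (Suc i + j) v)" by (subst Suc.IH) simp
  finally show ?case .
qed simp

text \<open>Two walks with \<open>m\<close> vertices joined by an edge form a walk with
  \<open>2 * m\<close> vertices; counted in steps,
  \<open>(m - 1) + 1 + (m - 1) = 2 * m - 1\<close>.\<close>

lemma adj_form_walks:
  assumes "1 \<le> m"
  shows "adj_form (walks (m - 1)) (walks (m - 1)) = tot (2 * m)"
proof -
  have "adj_form (walks (m - 1)) (walks (m - 1)) = (\<Sum>v\<in>V. walks (m - 1) v * walks (Suc (m - 1)) v)"
    by (simp add: adj_form_def)
  also have "\<dots> = tot (2 * m)"
    unfolding sum_walks_mult tot_def using assms by (intro sum.cong) (auto intro!: arg_cong2[of _ _ _ _ walks])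
  finally show ?thesis .
qed

text \<open>With \<open>M\<close> the largest entry of \<open>\<bar>x\<bar>\<close>, applying the
  operator \<open>k\<close> times to \<open>\<bar>x\<bar> \<le> M\<close> bounds
  \<open>\<bar>\<mu>\<bar> ^ k * \<bar>x u\<bar>\<close> by \<open>M * walks k u\<close>; at a
  vertex attaining the maximum, \<open>M\<close> cancels.\<close>

lemma eigenvalue_power_le_walks:
  assumes "v0 \<in> V" "x v0 \<noteq> 0" and eig: "\<And>u. u \<in> V \<Longrightarrow> nbr x u = \<mu> * x u"
  shows "\<bar>\<mu>\<bar> ^ k \<le> (\<Sum>v\<in>V. walks k v)"
proof -
  define M where "M = Max ((\<lambda>v. \<bar>x v\<bar>) ` V)"
  have "M \<in> (\<lambda>v. \<bar>x v\<bar>) ` V" using assms fin by (auto simp: M_def intro!: Max_in)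
  then obtain v where v: "v \<in> V" "M = \<bar>x v\<bar>" by auto
  have M: "\<bar>x u\<bar> \<le> M" if "u \<in> V" for u using that fin by (simp add: M_def)
  have "0 < M" using M[of v0] assms by simp
  have "\<bar>\<mu>\<bar> ^ k * \<bar>x u\<bar> \<le> M * walks k u" if "u \<in> V" for u
    using that
  proof (induction k arbitrary: u)
    case (Suc k)
    have "\<bar>\<mu>\<bar> ^ Suc k * \<bar>x u\<bar> = \<bar>\<mu>\<bar> ^ k * \<bar>nbr x u\<bar>"
      by (simp add: eig[OF Suc.prems] abs_mult)
    also have "\<dots> \<le> \<bar>\<mu>\<bar> ^ k * nbr (\<lambda>v. \<bar>x v\<bar>) u"
      by (intro mult_left_mono abs_nbr_le) auto
    also have "\<dots> = nbr (\<lambda>v. \<bar>\<mu>\<bar> ^ k * \<bar>x v\<bar>) u" by (simp add: nbr_scaled)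
    also have "\<dots> \<le> nbr (\<lambda>v. M * walks k v) u" by (intro nbr_mono Suc.IH)
    also have "\<dots> = M * walks (Suc k) u" by (simp add: nbr_scaled)
    finally show ?case .
  qed (use M in simp)
  from this[OF v(1)] have "\<bar>\<mu>\<bar> ^ k \<le> walks k v" using v \<open>0 < M\<close> by simp
  also have "\<dots> \<le> (\<Sum>v\<in>V. walks k v)"
    using v fin walks_nonneg by (intro member_le_sum) auto
  finally show ?thesis .
qed

text \<open>A Perron-Frobenius argument:
  \<open>\<bar>\<mu>\<bar> * \<bar>x\<bar> \<le> A \<bar>x\<bar>\<close> holds entrywise, and
  pairing with the positive eigenvector \<open>y\<close> turns the right side into
  \<open>\<rho>\<close> times the same positive sum \<open>s\<close>.\<close>

lemma eigenvalue_le_positive_eigenvalue: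
  assumes "v0 \<in> V" "x v0 \<noteq> 0" and eig: "\<And>u. u \<in> V \<Longrightarrow> nbr x u = \<mu> * x u"
    and pos: "\<And>u. u \<in> V \<Longrightarrow> 0 < y u" and eigy: "\<And>u. u \<in> V \<Longrightarrow> nbr y u = \<rho> * y u"
  shows "\<bar>\<mu>\<bar> \<le> \<rho>"
proof -
  define s where "s = (\<Sum>u\<in>V. y u * \<bar>x u\<bar>)"
  have nonneg: "0 \<le> y u * \<bar>x u\<bar>" if "u \<in> V" for u using pos[OF that] by simp
  have "0 < y v0 * \<bar>x v0\<bar>" using pos assms(1,2) by simp
  also have "\<dots> \<le> s"
    unfolding s_def using assms(1) fin nonneg by (intro member_le_sum) auto
  finally have "0 < s" .
  have "\<bar>\<mu>\<bar> * s = (\<Sum>u\<in>V. y u * \<bar>nbr x u\<bar>)"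
    unfolding s_def sum_distrib_left by (intro sum.cong) (auto simp: eig abs_mult)
  also have "\<dots> \<le> adj_form y (\<lambda>u. \<bar>x u\<bar>)"
    unfolding adj_form_def using pos
    by (intro sum_mono mult_left_mono abs_nbr_le) (auto intro: less_imp_le)
  also have "\<dots> = adj_form (\<lambda>u. \<bar>x u\<bar>) y" by (rule adj_form_commute)
  also have "\<dots> = \<rho> * s"
    unfolding adj_form_def s_def sum_distrib_left by (intro sum.cong) (auto simp: eigy)
  finally show ?thesis using \<open>0 < s\<close> by simp
qed

text \<open>Doubling the number of vertices at most squares the normalised number of walks, which the
  \<open>2 ^ j\<close>-fold iterate compares with the spectral radius.\<close>

lemma eigenvalue_walk_bound:
  assumes "v0 \<in> V" "x v0 \<noteq> 0" "\<And>u. u \<in> V \<Longrightarrow> nbr x u = \<mu> * x u"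
    and "0 < a"
    and ms: "\<And>y. (\<And>v. v \<in> V \<Longrightarrow> 0 \<le> y v) \<Longrightarrow> adj_form y y \<le> a * (sum y V)\<^sup>2"
    and "1 \<le> m"
  shows "\<bar>\<mu>\<bar> ^ m \<le> a * tot m"
proof (rule le_of_power_of_two_bounds[where a = a and m = "\<bar>\<mu>\<bar>"])
  show "0 \<le> a * tot m" using \<open>0 < a\<close> walks_nonneg by (simp add: tot_def sum_nonneg)
  fix j
  have double: "a * tot (2 * n) \<le> (a * tot n)\<^sup>2" if "1 \<le> n" for n
  proof -
    have "adj_form (walks (n - 1)) (walks (n - 1)) \<le> a * (tot n)\<^sup>2"
      unfolding tot_def by (rule ms) (rule walks_nonneg)
    then have "a * tot (2 * n) \<le> a * (a * (tot n)\<^sup>2)"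
      unfolding adj_form_walks[OF that] using \<open>0 < a\<close> by (intro mult_left_mono) auto
    then show ?thesis by (simp add: power2_eq_square mult_ac)
  qed
  have iter: "a * tot (2 ^ j * m) \<le> (a * tot m) ^ 2 ^ j"
  proof (induction j)
    case (Suc j)
    have "a * tot (2 ^ Suc j * m) \<le> (a * tot (2 ^ j * m))\<^sup>2"
      using double[of "2 ^ j * m"] \<open>1 \<le> m\<close> by (simp add: mult.assoc)
    also have "\<dots> \<le> ((a * tot m) ^ 2 ^ j)\<^sup>2"
      using \<open>0 < a\<close> walks_nonneg by (intro power_mono Suc.IH) (simp add: tot_def sum_nonneg)
    finally show ?case by (simp add: power_mult[symmetric] mult.commute)
  qed simp
  \<comment> \<open>A walk with \<open>n\<close> vertices has only \<open>n - 1\<close> steps, so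
    one factor \<open>\<bar>\<mu>\<bar>\<close> is split off; it becomes the constant that the limit
    argument absorbs.\<close>
  have "a * (\<bar>\<mu>\<bar> ^ m) ^ 2 ^ j = \<bar>\<mu>\<bar> * (a * \<bar>\<mu>\<bar> ^ (2 ^ j * m - 1))"
  proof -
    have "\<bar>\<mu>\<bar> ^ (2 ^ j * m) = \<bar>\<mu>\<bar> * \<bar>\<mu>\<bar> ^ (2 ^ j * m - 1)"
      using \<open>1 \<le> m\<close> by (intro power_minus_mult[symmetric, THEN trans]) auto
    then show ?thesis by (simp add: power_mult[symmetric] mult.commute)
  qed
  also have "\<dots> \<le> \<bar>\<mu>\<bar> * (a * tot (2 ^ j * m))"
    using eigenvalue_power_le_walks[OF assms(1-3)] \<open>0 < a\<close>
    by (intro mult_left_mono) (auto simp: tot_def)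
  also have "\<dots> \<le> \<bar>\<mu>\<bar> * (a * tot m) ^ 2 ^ j" by (intro mult_left_mono iter) auto
  finally show "a * (\<bar>\<mu>\<bar> ^ m) ^ 2 ^ j \<le> \<bar>\<mu>\<bar> * (a * tot m) ^ 2 ^ j" .
qed (use assms in auto)

text \<open>Equality collapses the chain \<open>\<bar>\<mu>\<bar> ^ (2 * r) \<le> a * tot (2 * r)
  \<le> R\<^sup>2\<close>. Squaring its middle term, where \<open>tot (2 * r) = sum X V\<close>, and
  applying the walk bound with \<open>4 * r\<close> vertices gives the reverse of \<open>ms\<close>
  at \<open>X\<close>, so the unweighted inequality is tight there.\<close>

lemma weighted_eigenvalue_walk_bound:
  assumes eig: "v0 \<in> V" "x v0 \<noteq> 0" "\<And>u. u \<in> V \<Longrightarrow> nbr x u = \<mu> * x u"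
    and a: "0 < a"
    and ms: "\<And>y. (\<And>v. v \<in> V \<Longrightarrow> 0 \<le> y v) \<Longrightarrow> adj_form y y \<le> a * (sum y V)\<^sup>2"
    and g: "\<And>v. v \<in> V \<Longrightarrow> 0 \<le> g v"
    and msg: "\<And>y. (\<And>v. v \<in> V \<Longrightarrow> 0 \<le> y v) \<Longrightarrow> adj_form y y \<le> (\<Sum>v\<in>V. g v * y v)\<^sup>2"
    and r: "1 \<le> r"
  defines "R \<equiv> sqrt a * (\<Sum>v\<in>V. g v * walks (r - 1) v)"
    and "X \<equiv> walks (2 * r - 1)"
  shows "\<bar>\<mu>\<bar> ^ r \<le> R" and "\<bar>\<mu>\<bar> ^ r = R \<Longrightarrow> adj_form X X = a * (sum X V)\<^sup>2"
proof -
  note bound = eigenvalue_walk_bound[OF eig a ms]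
  have R0: "0 \<le> R"
    unfolding R_def using a g walks_nonneg by (intro mult_nonneg_nonneg sum_nonneg) auto
  have totR: "a * tot (2 * r) \<le> R\<^sup>2"
  proof -
    have "adj_form (walks (r - 1)) (walks (r - 1)) \<le> (\<Sum>v\<in>V. g v * walks (r - 1) v)\<^sup>2"
      by (rule msg) (rule walks_nonneg)
    then show ?thesis
      unfolding adj_form_walks[OF r] using a by (simp add: R_def power_mult_distrib)
  qed
  have "(\<bar>\<mu>\<bar> ^ r)\<^sup>2 = \<bar>\<mu>\<bar> ^ (2 * r)" by (simp add: power_mult[symmetric] mult.commute)
  also have "\<dots> \<le> a * tot (2 * r)" using bound r by simp
  finally have le: "(\<bar>\<mu>\<bar> ^ r)\<^sup>2 \<le> a * tot (2 * r)" .
  show "\<bar>\<mu>\<bar> ^ r \<le> R" using power2_le_imp_le[OF _ R0] le totR by simp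
  assume eq: "\<bar>\<mu>\<bar> ^ r = R"
  then have eq': "a * tot (2 * r) = \<bar>\<mu>\<bar> ^ (2 * r)"
    using le totR by (simp add: power_mult mult.commute[of 2])
  have XX: "adj_form X X = tot (2 * (2 * r))"
    using adj_form_walks[of "2 * r"] r by (simp add: X_def)
  have "a * (a * (sum X V)\<^sup>2) = (a * tot (2 * r))\<^sup>2"
    by (simp add: X_def tot_def power2_eq_square)
  also have "\<dots> = \<bar>\<mu>\<bar> ^ (2 * (2 * r))"
    unfolding eq' by (simp add: power_mult[symmetric] mult.commute)
  also have "\<dots> \<le> a * adj_form X X" unfolding XX using bound r by simp
  finally have "a * (sum X V)\<^sup>2 \<le> adj_form X X" using a by simp
  then show "adj_form X X = a * (sum X V)\<^sup>2"
    using ms[of X] walks_nonneg by (simp add: X_def order_antisym)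
qed

section \<open>Weights of the parts when non-adjacency is transitive\<close>

text \<open>The class of \<open>u\<close> once non-adjacency is known to be transitive; reflexivity
  and symmetry come from \<open>irrefl\<close> and \<open>sym\<close>.\<close>

abbreviation part :: "'a \<Rightarrow> 'a set" where
  "part u \<equiv> {v\<in>V. \<not> E u v}"

lemma part_self: "u \<in> V \<Longrightarrow> u \<in> part u"
  using irrefl by simp

lemma part_eq:
  assumes trans: "\<And>u v w. u \<in> V \<Longrightarrow> v \<in> V \<Longrightarrow> w \<in> V \<Longrightarrow> \<not> E u v \<Longrightarrow> \<not> E v w \<Longrightarrow> \<not> E u w"
    and "u \<in> V" "v \<in> part u"
  shows "part v = part u"
  using assms sym by blast

text \<open>Vertices of one part have the same neighbours, hence equally many walks.\<close>

lemma sum_walks_part: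
  assumes trans: "\<And>u v w. u \<in> V \<Longrightarrow> v \<in> V \<Longrightarrow> w \<in> V \<Longrightarrow> \<not> E u v \<Longrightarrow> \<not> E v w \<Longrightarrow> \<not> E u w"
    and u: "u \<in> V"
  shows "sum (walks k) (part u) = card (part u) * walks k u"
proof -
  have "walks k v = walks k u" if "v \<in> part u" for v
    using part_eq[OF trans u that] by (cases k) (simp_all add: nbr_eq_diff)
  then show ?thesis by simp
qed

text \<open>The third part, containing \<open>z\<close>, is essential: in an unbalanced complete bipartite graph
  both parts carry equally many walks with an even number of vertices.\<close>

lemma part_weights_less:
  assumes trans: "\<And>u v w. u \<in> V \<Longrightarrow> v \<in> V \<Longrightarrow> w \<in> V \<Longrightarrow> \<not> E u v \<Longrightarrow> \<not> E v w \<Longrightarrow> \<not> E u w"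
    and deg: "\<And>v. v \<in> V \<Longrightarrow> \<exists>u\<in>V. E v u"
    and V: "u \<in> V" "v \<in> V" "z \<in> V" and z: "E u z" "E v z"
    and less: "card (part u) < card (part v)"
  shows "walks k v \<le> walks k u \<and> card (part u) * walks k u < card (part v) * walks k v"
\<comment> \<open>The two inequalities need each other: the next comparison per vertex follows from
  the present comparison of weights, and the next comparison of weights uses the present one per
  vertex.\<close>
proof (induction k)
  case 0
  then show ?case using less by simp
next
  case (Suc k)
  define Q where "Q = sum (walks k) V"
  define m n where "m = real (card (part u))" and "n = real (card (part v))"
  have mn: "m < n" "0 \<le> m" using less by (auto simp: m_def n_def)
  have sum_u: "sum (walks k) (part u) = m * walks k u"
    unfolding m_def by (rule sum_walks_part[OF _ V(1)]) (rule trans)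
  have sum_v: "sum (walks k) (part v) = n * walks k v"
    unfolding n_def by (rule sum_walks_part[OF _ V(2)]) (rule trans)
  have step: "walks (Suc k) u = Q - m * walks k u" "walks (Suc k) v = Q - n * walks k v"
    by (simp_all only: walks.simps nbr_eq_diff Q_def sum_u sum_v)
  have IH: "walks k v \<le> walks k u" "m * walks k u < n * walks k v"
    using Suc.IH by (auto simp: m_def n_def)
  have False if "x \<in> part u" "x \<in> part v" for x
    using part_eq[OF trans V(1) that(1)] part_eq[OF trans V(2) that(2)] less by simp
  then have disj: "part u \<inter> part v = {}" "z \<notin> part u \<union> part v"
    using z by blast+
  have "sum (walks k) (insert z (part u \<union> part v)) \<le> Q"
    unfolding Q_def using V walks_nonneg fin by (intro sum_mono2) auto
  then have "walks k z + (sum (walks k) (part u) + sum (walks k) (part v)) \<le> Q"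
    using disj fin by (simp add: sum.union_disjoint)
  then have "walks k z + (m * walks k u + n * walks k v) \<le> Q"
    unfolding sum_u sum_v .
  \<comment> \<open>The vertex \<open>z\<close> outside both parts makes the next inequality
    strict.\<close>
  moreover have "0 < walks k z" using walks_pos[OF deg V(3)] .
  moreover have "m * walks k v \<le> m * walks k u" using IH mn by (intro mult_left_mono) auto
  ultimately have "0 < Q - (m + n) * walks k v" by (simp add: algebra_simps)
  \<comment> \<open>Expanded, this reads
    \<open>m * (Q - m * walks k v) < n * (Q - n * walks k v)\<close>; on the left,
    \<open>walks k v\<close> may then be replaced by the larger \<open>walks k u\<close>.\<close>
  then have "0 < (n - m) * (Q - (m + n) * walks k v)" using mn by simp
  moreover have "m * m * walks k v \<le> m * m * walks k u" using IH mn by (intro mult_left_mono) auto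
  ultimately have "m * (Q - m * walks k u) < n * (Q - n * walks k v)" by (simp add: algebra_simps)
  moreover have "Q - n * walks k v \<le> Q - m * walks k u" using IH by simp
  ultimately show ?case unfolding step m_def n_def by blast
qed

text \<open>A constant \<open>nbr (walks k)\<close> means that all parts carry the same weight, by
  \<open>nbr_eq_diff\<close>. Parts of different sizes would contradict the strict inequality of
  \<open>part_weights_less\<close>, since the clique supplies a vertex of a third part.\<close>

lemma equal_part_weights_imp_equal_parts:
  assumes trans: "\<And>u v w. u \<in> V \<Longrightarrow> v \<in> V \<Longrightarrow> w \<in> V \<Longrightarrow> \<not> E u v \<Longrightarrow> \<not> E v w \<Longrightarrow> \<not> E u w"
    and deg: "\<And>v. v \<in> V \<Longrightarrow> \<exists>u\<in>V. E v u"
    and const: "\<And>u v. u \<in> V \<Longrightarrow> v \<in> V \<Longrightarrow> nbr (walks k) u = nbr (walks k) v"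
    and K: "K \<subseteq> V" "pairwise E K" "3 \<le> card K"
    and uv: "u \<in> V" "v \<in> V"
  shows "card (part u) = card (part v)"
proof (rule ccontr)
  assume "card (part u) \<noteq> card (part v)"
  \<comment> \<open>A part contains at most one vertex of \<open>K\<close>, so two parts cannot
    cover three clique vertices.\<close>
  have sub1: "\<exists>x. part w \<inter> K \<subseteq> {x}" if "w \<in> V" for w
  proof -
    have "x = y" if "x \<in> part w \<inter> K" "y \<in> part w \<inter> K" for x y
    proof (rule ccontr)
      assume "x \<noteq> y"
      then have "E x y" using K that by (auto simp: pairwise_def)
      moreover have "\<not> E x y" using trans[of x w y] that \<open>w \<in> V\<close> sym by blast
      ultimately show False by simp
    qed
    then show ?thesis by blast
  qed
  obtain x y where "part u \<inter> K \<subseteq> {x}" "part v \<inter> K \<subseteq> {y}" using sub1 uv by meson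
  moreover have "\<not> K \<subseteq> {x, y}"
  proof
    assume "K \<subseteq> {x, y}"
    then have "card K \<le> card {x, y}" by (intro card_mono) auto
    also have "\<dots> \<le> 2" by (simp add: card_insert_if)
    finally show False using K by simp
  qed
  ultimately obtain z where z: "z \<in> V" "E u z" "E v z" using K by blast
  have w: "card (part u) * walks k u = card (part v) * walks k v"
    using const[OF uv] by (simp add: nbr_eq_diff sum_walks_part[OF trans] uv)
  from \<open>card (part u) \<noteq> card (part v)\<close> consider
    "card (part u) < card (part v)" | "card (part v) < card (part u)" by linarith
  then show False
  proof cases
    case 1
    then show ?thesis using part_weights_less[OF trans deg uv z 1, where k = k] w by simp
  next
    case 2
    then show ?thesis using part_weights_less[OF trans deg uv(2,1) z(1,3,2) 2, where k = k] w by simp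
  qed
qed

end

section \<open>Existence of real eigenvalues of symmetric matrices\<close>

text \<open>A complex eigenvalue exists and is real by symmetry. The real and imaginary parts of its
  eigenvector then satisfy the same real equation, and one of them is nonzero.\<close>

lemma real_symmetric_spectrum_nonempty:
  fixes A :: "real mat"
  assumes A: "A \<in> carrier_mat n n" and "n > 0"
    and symA: "\<And>i j. i < n \<Longrightarrow> j < n \<Longrightarrow> A $$ (i, j) = A $$ (j, i)"
  shows "spectrum A \<noteq> {}"
proof -
  define C where "C = map_mat complex_of_real A"
  have C: "C \<in> carrier_mat n n" using A by (simp add: C_def)
  then obtain \<mu> z where ev: "eigenvector C z \<mu>"
    using spectrum_non_empty[OF C \<open>n > 0\<close>] by (auto simp: spectrum_def eigenvalue_def)
  have dim: "dim_vec z = n" "dim_row A = n" "dim_col A = n"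
    using ev C A by (auto simp: eigenvector_def)
  have mv: "(\<Sum>j<n. complex_of_real (A $$ (i, j)) * z $ j) = \<mu> * z $ i" if "i < n" for i
  proof -
    have "(C *\<^sub>v z) $ i = (\<mu> \<cdot>\<^sub>v z) $ i" using ev by (simp add: eigenvector_def)
    then show ?thesis
      using that dim by (simp add: C_def scalar_prod_def atLeast0LessThan)
  qed
  obtain i0 where i0: "i0 < n" "z $ i0 \<noteq> 0"
    using ev C dim by (auto simp: eigenvector_def vec_eq_iff)
  define s where "s = (\<Sum>i<n. (cmod (z $ i))\<^sup>2)"
  have "0 < (cmod (z $ i0))\<^sup>2" using i0 by simp
  also have "\<dots> \<le> s" unfolding s_def using i0 by (intro member_le_sum) auto
  finally have "0 < s" .
  \<comment> \<open>The Hermitian form of \<open>A\<close> at \<open>z\<close>: it equals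
    \<open>\<mu>\<close> times the squared norm \<open>s\<close>, and symmetry makes it its own
    conjugate.\<close>
  define T where "T = (\<Sum>i<n. \<Sum>j<n. cnj (z $ i) * (complex_of_real (A $$ (i, j)) * z $ j))"
  have "T = (\<Sum>i<n. cnj (z $ i) * (\<mu> * z $ i))"
    unfolding T_def sum_distrib_left[symmetric] by (intro sum.cong) (auto simp: mv)
  also have "\<dots> = \<mu> * complex_of_real s"
    unfolding s_def of_real_sum sum_distrib_left
    by (intro sum.cong refl, subst complex_norm_square) (simp add: mult_ac)
  finally have T: "T = \<mu> * complex_of_real s" .
  have "cnj T = (\<Sum>i<n. \<Sum>j<n. z $ i * (complex_of_real (A $$ (i, j)) * cnj (z $ j)))"
    unfolding T_def by simp
  also have "\<dots> = (\<Sum>j<n. \<Sum>i<n. z $ i * (complex_of_real (A $$ (i, j)) * cnj (z $ j)))"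
    by (rule sum.swap)
  also have "\<dots> = T" unfolding T_def by (intro sum.cong) (auto simp: symA)
  finally have "cnj T = T" .
  then have "cnj \<mu> = \<mu>" using \<open>0 < s\<close> by (simp add: T)
  then have \<mu>: "\<mu> = complex_of_real (Re \<mu>)" by (simp add: complex_eq_iff)
  have eigen: "Re \<mu> \<in> spectrum A" if "x i0 \<noteq> 0"
    and "\<And>i. i < n \<Longrightarrow> (\<Sum>j<n. A $$ (i, j) * x j) = Re \<mu> * x i" for x :: "nat \<Rightarrow> real"
  proof -
    have "eigenvector A (vec n x) (Re \<mu>)"
      unfolding eigenvector_def using that i0 dim
      by (auto simp: vec_eq_iff scalar_prod_def atLeast0LessThan)
    then show ?thesis by (auto simp: spectrum_def eigenvalue_def)
  qed
  have re: "(\<Sum>j<n. A $$ (i, j) * Re (z $ j)) = Re \<mu> * Re (z $ i)" if "i < n" for i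
    using arg_cong[OF mv[OF that], of Re] by (subst (asm) \<mu>) simp
  have im: "(\<Sum>j<n. A $$ (i, j) * Im (z $ j)) = Re \<mu> * Im (z $ i)" if "i < n" for i
    using arg_cong[OF mv[OF that], of Im] by (subst (asm) \<mu>) simp
  show ?thesis
  proof (cases "Re (z $ i0) = 0")
    case True
    then have "Im (z $ i0) \<noteq> 0" using i0 by (simp add: complex_eq_iff)
    then show ?thesis using eigen[of "\<lambda>i. Im (z $ i)"] im by blast
  next
    case False
    then show ?thesis using eigen[of "\<lambda>i. Re (z $ i)"] re by blast
  qed
qed

section \<open>Eigenvalues, walks and cliques of a graph\<close>

sublocale graph \<subseteq> adj: finite_adjacency "verts G" "\<lambda>u v. u \<rightarrow>\<^bsub>G\<^esub> v"
proof
  show "u \<rightarrow>\<^bsub>G\<^esub> v \<Longrightarrow> v \<rightarrow>\<^bsub>G\<^esub> u" for u v using sym_arcs by (auto simp: symmetric_def elim: symE)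
  show "\<not> u \<rightarrow>\<^bsub>G\<^esub> u" for u using adj_not_same by blast
qed simp

context graph
begin

definition eigenvalues :: "real set" where
  "eigenvalues =
    {\<mu>. \<exists>x. (\<exists>v\<in>verts G. x v \<noteq> 0) \<and> (\<forall>u\<in>verts G. adj.nbr x u = \<mu> * x u)}"

text \<open>Ensures that the \<open>Max\<close> in \<open>lambda1\<close> is attained: a matrix has
  a finite spectrum, and real symmetry makes it nonempty.\<close>

lemma lambda1_eq_Max:
  assumes "verts G \<noteq> {}"
  shows "lambda1 G = Max eigenvalues" "finite eigenvalues" "eigenvalues \<noteq> {}"
proof -
  define vs where "vs = (SOME vs. distinct vs \<and> set vs = verts G)"
  have "\<exists>vs. distinct vs \<and> set vs = verts G" using finite_distinct_list[OF finite_verts] by blast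
  then have vs: "distinct vs" "set vs = verts G"
    unfolding vs_def by (metis (mono_tags, lifting) someI_ex)+
  define A where "A = adjacency_mat G vs"
  have A: "A \<in> carrier_mat (length vs) (length vs)" by (simp add: A_def adjacency_mat_def)
  have "eigenvalues = spectrum A"
    unfolding eigenvalues_def spectrum_def A_def using eigenvalue_adjacency_mat[OF vs, of G]
    by (auto simp: adj.nbr_def)
  moreover have "spectrum A \<noteq> {}"
  proof (rule real_symmetric_spectrum_nonempty[OF A])
    show "0 < length vs" using vs assms by auto
    fix i j assume "i < length vs" "j < length vs"
    then show "A $$ (i, j) = A $$ (j, i)"
      using adj.sym[of "vs ! i" "vs ! j"] adj.sym[of "vs ! j" "vs ! i"]
      by (auto simp: A_def adjacency_mat_def)
  qed
  moreover have "lambda1 G = Max (spectrum A)" by (simp add: lambda1_def A_def vs_def)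
  ultimately show "lambda1 G = Max eigenvalues" "finite eigenvalues" "eigenvalues \<noteq> {}"
    using card_finite_spectrum[OF A] by simp_all
qed

lemma lambda1_eigenvector:
  assumes "verts G \<noteq> {}"
  obtains x v0 where "v0 \<in> verts G" "x v0 \<noteq> 0"
    "\<And>u. u \<in> verts G \<Longrightarrow> adj.nbr x u = lambda1 G * x u"
proof -
  have "lambda1 G \<in> eigenvalues" using lambda1_eq_Max[OF assms] by simp
  then show thesis using that by (auto simp: eigenvalues_def)
qed

text \<open>A positive eigenvector belongs to the largest eigenvalue. This computes
  \<open>lambda1\<close> for edgeless, regular and complete bipartite graphs.\<close>

lemma lambda1_eqI:
  assumes ne: "verts G \<noteq> {}" and pos: "\<And>u. u \<in> verts G \<Longrightarrow> 0 < y u"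
    and eig: "\<And>u. u \<in> verts G \<Longrightarrow> adj.nbr y u = \<rho> * y u"
  shows "lambda1 G = \<rho>"
  unfolding lambda1_eq_Max(1)[OF ne]
proof (rule Max_eqI[OF lambda1_eq_Max(2)[OF ne]])
  obtain v where v: "v \<in> verts G" using ne by blast
  then have "y v \<noteq> 0" using pos[OF v] by simp
  then show "\<rho> \<in> eigenvalues" using eig v by (auto simp: eigenvalues_def)
  fix \<mu> assume "\<mu> \<in> eigenvalues"
  then obtain x v0 where "v0 \<in> verts G" "x v0 \<noteq> 0" "\<forall>u\<in>verts G. adj.nbr x u = \<mu> * x u"
    by (auto simp: eigenvalues_def)
  then have "\<bar>\<mu>\<bar> \<le> \<rho>"
    using adj.eigenvalue_le_positive_eigenvalue[of v0 x \<mu> y \<rho>] pos eig by blast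
  then show "\<mu> \<le> \<rho>" by simp
qed

text \<open>Walks are split by their second vertex. The shift by one reconciles counting vertices
  with counting steps.\<close>

lemma num_walks_eq_walks:
  assumes "v \<in> verts G"
  shows "real (num_walks G (Suc k) v) = adj.walks k v"
  using assms
proof (induction k arbitrary: v)
  case 0
  then have "{p. vwalk p G \<and> length p = Suc 0 \<and> hd p = v} = {[v]}"
    by (auto simp: vwalk_def length_Suc_conv)
  then show ?case by (simp add: num_walks_def)
next
  case (Suc k)
  define W where "W l u = {p. vwalk p G \<and> length p = Suc l \<and> hd p = u}" for l u
  have finW: "finite (W l u)" for l u
    by (rule finite_subset[OF _ finite_lists_length_eq[OF finite_verts, of "Suc l"]])
      (auto simp: W_def vwalk_def)
  define N where "N = {u \<in> verts G. v \<rightarrow>\<^bsub>G\<^esub> u}"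
  have "W (Suc k) v = (\<Union>u\<in>N. (#) v ` W k u)"
  proof (intro equalityI subsetI)
    fix p assume p: "p \<in> W (Suc k) v"
    then obtain q where q: "p = v # q" "length q = Suc k"
      by (auto simp: W_def length_Suc_conv)
    then have "q \<noteq> []" by auto
    then have "vwalk q G" "v \<rightarrow>\<^bsub>G\<^esub> hd q" using p q by (auto simp: W_def elim: vwalk_consE)
    then show "p \<in> (\<Union>u\<in>N. (#) v ` W k u)"
      using q by (auto simp: W_def N_def intro: adj_in_verts)
  next
    fix p assume "p \<in> (\<Union>u\<in>N. (#) v ` W k u)"
    then show "p \<in> W (Suc k) v"
      using Suc.prems by (auto simp: W_def N_def intro: vwalk_consI)
  qed
  moreover have "card (\<Union>u\<in>N. (#) v ` W k u) = (\<Sum>u\<in>N. card ((#) v ` W k u))"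
    using finW by (intro card_UN_disjoint) (auto simp: N_def W_def)
  moreover have "card ((#) v ` W k u) = num_walks G (Suc k) u" for u
    by (simp add: card_image num_walks_def W_def)
  ultimately have "num_walks G (Suc (Suc k)) v = (\<Sum>u\<in>N. num_walks G (Suc k) u)"
    by (simp add: num_walks_def W_def)
  then have "real (num_walks G (Suc (Suc k)) v) = (\<Sum>u\<in>N. adj.walks k u)"
    using Suc.IH by (simp add: N_def)
  also have "\<dots> = adj.walks (Suc k) v"
    unfolding N_def by (simp add: adj.nbr_def sum.If_cases Int_def)
  finally show ?case .
qed

lemma out_degree_eq_card: "out_degree G v = card {u \<in> verts G. v \<rightarrow>\<^bsub>G\<^esub> u}"
proof -
  have "inj_on (head G) (out_arcs G v)"
    using no_multi_arcs by (auto simp: inj_on_def arc_to_ends_def)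
  moreover have "head G ` out_arcs G v = {u \<in> verts G. v \<rightarrow>\<^bsub>G\<^esub> u}"
    by (auto simp: arcs_ends_def arc_to_ends_def)
  ultimately show ?thesis unfolding out_degree_def by (metis card_image)
qed

lemma clique_iff_pairwise: "clique G S \<longleftrightarrow> S \<subseteq> verts G \<and> pairwise (\<lambda>u v. u \<rightarrow>\<^bsub>G\<^esub> v) S"
  by (auto simp: clique_def pairwise_def)

lemma finite_clique_sizes: "finite {card S |S. clique G S \<and> Q S}"
  by (rule finite_subset[of _ "card ` Pow (verts G)"]) (auto simp: clique_def)

lemma card_clique_le: "clique G S \<Longrightarrow> card S \<le> clique_number G"
  unfolding clique_number_def using finite_clique_sizes[of "\<lambda>_. True"] by (intro Max_ge) auto

lemma max_clique_exists: obtains S where "clique G S" "card S = clique_number G"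
proof -
  have "clique G {}" by (simp add: clique_def)
  then have "clique_number G \<in> {card S |S. clique G S}"
    unfolding clique_number_def using finite_clique_sizes[of "\<lambda>_. True"] by (intro Max_in) auto
  then show thesis using that by force
qed

lemma card_clique_le_at: "clique G S \<Longrightarrow> v \<in> S \<Longrightarrow> card S \<le> clique_number_at G v"
  unfolding clique_number_at_def using finite_clique_sizes[of "\<lambda>S. v \<in> S"] by (intro Max_ge) auto

lemma clique_number_at_bounds:
  assumes "v \<in> verts G"
  shows "1 \<le> clique_number_at G v" "clique_number_at G v \<le> clique_number G"
proof -
  have v: "clique G {v}" using assms by (simp add: clique_def)
  then show "1 \<le> clique_number_at G v" using card_clique_le_at[OF v] by simp
  have "clique_number_at G v \<in> {card S |S. clique G S \<and> v \<in> S}"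
    unfolding clique_number_at_def using finite_clique_sizes[of "\<lambda>S. v \<in> S"] v
    by (intro Max_in) auto
  then show "clique_number_at G v \<le> clique_number G" using card_clique_le by force
qed

text \<open>A clique through \<open>v\<close> has at most \<open>clique_number_at G v\<close>
  vertices, which is the weight hypothesis of the general inequality. Every vertex lies on an edge,
  so these clique numbers are at least 2 and the weights are positive.\<close>

lemma motzkin_straus_clique_number_at:
  assumes deg: "\<And>v. v \<in> verts G \<Longrightarrow> \<exists>u\<in>verts G. v \<rightarrow>\<^bsub>G\<^esub> u"
    and y: "\<And>v. v \<in> verts G \<Longrightarrow> 0 \<le> y v"
  shows "adj.adj_form y y \<le> (\<Sum>v\<in>verts G. sqrt (1 - 1 / clique_number_at G v) * y v)\<^sup>2"
proof (rule adj.weighted_motzkin_straus[OF _ _ y])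
  show "0 < sqrt (1 - 1 / clique_number_at G v)" if v: "v \<in> verts G" for v
  proof -
    obtain u where u: "u \<in> verts G" "v \<rightarrow>\<^bsub>G\<^esub> u" using deg v by blast
    then have "clique G {v, u}" "v \<noteq> u" using v adj.sym adj.irrefl by (auto simp: clique_def)
    then have "2 \<le> clique_number_at G v" using card_clique_le_at[of "{v, u}" v] by simp
    then show ?thesis by simp
  qed
  fix K v assume K: "K \<subseteq> verts G" "pairwise (\<lambda>u v. u \<rightarrow>\<^bsub>G\<^esub> v) K" "v \<in> K"
  then have "card K \<le> clique_number_at G v"
    using card_clique_le_at[of K v] by (simp add: clique_iff_pairwise)
  moreover have "0 < card K" using K finite_subset[OF K(1)] by (auto simp: card_gt_0_iff)
  ultimately show "1 - 1 / real (card K) \<le> (sqrt (1 - 1 / clique_number_at G v))\<^sup>2"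
    by (simp add: frac_le)
qed

lemma motzkin_straus_clique_number:
  assumes two: "2 \<le> clique_number G" and y: "\<And>v. v \<in> verts G \<Longrightarrow> 0 \<le> y v"
  shows "adj.adj_form y y \<le> (1 - 1 / clique_number G) * (sum y (verts G))\<^sup>2"
proof -
  have "adj.adj_form y y \<le> (\<Sum>v\<in>verts G. sqrt (1 - 1 / clique_number G) * y v)\<^sup>2"
  proof (rule adj.weighted_motzkin_straus[OF _ _ y])
    show "0 < sqrt (1 - 1 / clique_number G)" using two by simp
    fix K v assume K: "K \<subseteq> verts G" "pairwise (\<lambda>u v. u \<rightarrow>\<^bsub>G\<^esub> v) K" "v \<in> K"
    then have "card K \<le> clique_number G"
      using card_clique_le[of K] by (simp add: clique_iff_pairwise)
    moreover have "0 < card K" using K finite_subset[OF K(1)] by (auto simp: card_gt_0_iff)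
    ultimately show "1 - 1 / real (card K) \<le> (sqrt (1 - 1 / clique_number G))\<^sup>2"
      by (simp add: frac_le)
  qed
  also have "\<dots> = (1 - 1 / clique_number G) * (sum y (verts G))\<^sup>2"
    using two by (simp add: sum_distrib_left[symmetric] power_mult_distrib)
  finally show ?thesis .
qed

section \<open>Complete multipartite graphs and their walk counts\<close>

text \<open>The parts are the classes of non-adjacency. Representatives of all parts form a clique,
  and a largest clique meets each part at most once, so there are \<open>clique_number G\<close>
  parts.\<close>

lemma nonadjacent_trans_imp_complete_multipartite:
  assumes trans: "\<And>u v w. u \<in> verts G \<Longrightarrow> v \<in> verts G \<Longrightarrow> w \<in> verts G \<Longrightarrow>
      \<not> u \<rightarrow>\<^bsub>G\<^esub> v \<Longrightarrow> \<not> v \<rightarrow>\<^bsub>G\<^esub> w \<Longrightarrow> \<not> u \<rightarrow>\<^bsub>G\<^esub> w"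
  shows "complete_multipartite (clique_number G) G"
proof -
  define P where "P = adj.part ` verts G"
  have part_eq: "adj.part v = adj.part u" if "u \<in> verts G" "v \<in> adj.part u" for u v
    by (rule adj.part_eq[OF _ that]) (rule trans)
  have adjP: "u \<rightarrow>\<^bsub>G\<^esub> v \<longleftrightarrow> \<not> (\<exists>X\<in>P. u \<in> X \<and> v \<in> X)" if uv: "u \<in> verts G" "v \<in> verts G" for u v
  proof
    show "\<not> (\<exists>X\<in>P. u \<in> X \<and> v \<in> X)" if "u \<rightarrow>\<^bsub>G\<^esub> v"
      using trans[OF uv(1) _ uv(2)] that adj.sym by (auto simp: P_def)
    show "u \<rightarrow>\<^bsub>G\<^esub> v" if "\<not> (\<exists>X\<in>P. u \<in> X \<and> v \<in> X)"
      using that uv adj.part_self[OF uv(1)] by (auto simp: P_def)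
  qed
  have part: "partition_on (verts G) P"
  proof (rule partition_onI)
    show "\<Union> P = verts G" using adj.part_self by (auto simp: P_def)
    show "{} \<notin> P" using adj.part_self by (auto simp: P_def)
    show "disjnt X Y" if XY: "X \<in> P" "Y \<in> P" "X \<noteq> Y" for X Y
    proof -
      obtain u v where uv: "u \<in> verts G" "X = adj.part u" "v \<in> verts G" "Y = adj.part v"
        using XY by (auto simp: P_def)
      have False if "z \<in> X" "z \<in> Y" for z
        using part_eq[of u z] part_eq[of v z] uv that XY(3) by simp
      then show ?thesis by (auto simp: disjnt_def)
    qed
  qed
  have "card P = clique_number G"
  proof (rule antisym)
    define f where "f X = (SOME x. x \<in> X)" for X :: "'a set"
    have f: "f X \<in> X" if "X \<in> P" for X
      unfolding f_def using partition_onD3[OF part] that by (metis some_in_eq)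
    have disj: "X = Y" if "X \<in> P" "Y \<in> P" "z \<in> X" "z \<in> Y" for X Y z
      using partition_onD2[OF part] that by (auto simp: disjoint_def)
    have inj: "inj_on f P" using f disj by (metis inj_onI)
    have "clique G (f ` P)"
      unfolding clique_def
    proof (intro conjI ballI impI)
      show "f ` P \<subseteq> verts G" using f partition_onD1[OF part] by blast
      fix a b assume ab: "a \<in> f ` P" "b \<in> f ` P" "a \<noteq> b"
      then obtain X Y where XY: "X \<in> P" "a = f X" "Y \<in> P" "b = f Y" by blast
      have "a \<in> verts G" "b \<in> verts G" using XY f partition_onD1[OF part] by blast+
      moreover have "\<not> (\<exists>Z\<in>P. a \<in> Z \<and> b \<in> Z)"
        using XY f disj ab(3) by metis
      ultimately show "a \<rightarrow>\<^bsub>G\<^esub> b" using adjP by blast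
    qed
    then show "card P \<le> clique_number G"
      using card_clique_le[of "f ` P"] card_image[OF inj] by simp
  next
    obtain S where S: "clique G S" "card S = clique_number G" by (rule max_clique_exists)
    have "inj_on adj.part S"
    proof (rule inj_onI, rule ccontr)
      fix u v assume uv: "u \<in> S" "v \<in> S" "adj.part u = adj.part v" "u \<noteq> v"
      then have "u \<rightarrow>\<^bsub>G\<^esub> v" "v \<in> verts G" using S by (auto simp: clique_def)
      then show False using adj.part_self[of v] uv(3) by blast
    qed
    then have "card S = card (adj.part ` S)" by (simp add: card_image)
    also have "\<dots> \<le> card P"
      using S by (intro card_mono) (auto simp: P_def clique_def)
    finally show "clique_number G \<le> card P" using S by simp
  qed
  then show ?thesis unfolding complete_multipartite_def using part adjP by blast
qed

lemma complete_multipartite_2_imp_bipartite: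
  assumes "complete_multipartite 2 G"
  shows "\<exists>m n. complete_bipartite_digraph m n G"
proof -
  obtain P where P: "partition_on (verts G) P" "card P = 2"
    "\<forall>u\<in>verts G. \<forall>v\<in>verts G. u \<rightarrow>\<^bsub>G\<^esub> v \<longleftrightarrow> \<not> (\<exists>X\<in>P. u \<in> X \<and> v \<in> X)"
    using assms by (auto simp: complete_multipartite_def)
  then obtain X Y where XY: "P = {X, Y}" "X \<noteq> Y" by (auto simp: card_2_iff)
  have V: "verts G = X \<union> Y" "X \<inter> Y = {}"
    using partition_onD1[OF P(1)] partition_onD2[OF P(1)] XY by (auto simp: disjoint_def)
  have "arcs_ends G = X \<times> Y \<union> Y \<times> X"
  proof (intro equalityI subsetI)
    fix e assume "e \<in> arcs_ends G"
    moreover obtain u v where "e = (u, v)" by (cases e)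
    ultimately show "e \<in> X \<times> Y \<union> Y \<times> X" using P(3) V XY adj_in_verts[of u v] by auto
  next
    fix e assume "e \<in> X \<times> Y \<union> Y \<times> X"
    then show "e \<in> arcs_ends G" using P(3) V XY by auto
  qed
  then show ?thesis using V graph_axioms unfolding complete_bipartite_digraph_def by blast
qed

text \<open>For degree \<open>d\<close> the constant vector gives \<open>lambda1 G = d\<close> and
  \<open>walks j = d ^ j\<close>. A vertex is joined to everything outside its part, so each of the
  \<open>k\<close> parts has \<open>n - d\<close> vertices; then \<open>n = k * (n - d)\<close>,
  that is \<open>(1 - 1 / k) * n = d\<close>.\<close>

lemma regular_multipartite_walks:
  assumes ne: "verts G \<noteq> {}" and mult: "complete_multipartite k G" and "regular G"
    and "0 < k" "1 \<le> r"
  shows "lambda1 G ^ r = (1 - 1 / k) * adj.tot r"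
proof -
  obtain d where "\<forall>v\<in>verts G. out_degree G v = d" using \<open>regular G\<close> by (auto simp: regular_def)
  then have deg: "card {u \<in> verts G. v \<rightarrow>\<^bsub>G\<^esub> u} = d" if "v \<in> verts G" for v
    using that by (simp add: out_degree_eq_card)
  have nbr1: "adj.nbr (\<lambda>_. c) v = c * d" if "v \<in> verts G" for v c
    using that by (simp add: adj.nbr_const deg)
  have walks: "adj.walks j v = real d ^ j" if "v \<in> verts G" for j v
    using that
  proof (induction j arbitrary: v)
    case (Suc j)
    have "adj.walks (Suc j) v = adj.nbr (\<lambda>_. real d ^ j) v"
      by (simp, rule adj.nbr_cong) (rule Suc.IH)
    then show ?case using nbr1[OF Suc.prems] by simp
  qed simp
  have lam: "lambda1 G = d"
    using lambda1_eqI[OF ne, of "\<lambda>_. 1" d] nbr1[of _ 1] by simp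
  obtain P where P: "partition_on (verts G) P" "card P = k"
    "\<forall>u\<in>verts G. \<forall>v\<in>verts G. u \<rightarrow>\<^bsub>G\<^esub> v \<longleftrightarrow> \<not> (\<exists>X\<in>P. u \<in> X \<and> v \<in> X)"
    using mult by (auto simp: complete_multipartite_def)
  define n where "n = card (verts G)"
  have sub: "X \<subseteq> verts G" if "X \<in> P" for X using partition_onD1[OF P(1)] that by blast
  have disj: "X = Y" if "X \<in> P" "Y \<in> P" "z \<in> X" "z \<in> Y" for X Y z
    using partition_onD2[OF P(1)] that by (auto simp: disjoint_def)
  have size: "card X + d = n" if X: "X \<in> P" for X
  proof -
    have "X \<noteq> {}" using partition_onD3[OF P(1)] X by blast
    then obtain u where u: "u \<in> X" by blast
    then have uV: "u \<in> verts G" using sub[OF X] by blast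
    have "{v \<in> verts G. u \<rightarrow>\<^bsub>G\<^esub> v} = verts G - X"
    proof (intro equalityI subsetI)
      fix v assume "v \<in> {v \<in> verts G. u \<rightarrow>\<^bsub>G\<^esub> v}"
      then show "v \<in> verts G - X" using P(3) uV u X by blast
    next
      fix v assume v: "v \<in> verts G - X"
      then have "\<not> (\<exists>Y\<in>P. u \<in> Y \<and> v \<in> Y)" using disj[OF X _ u] by blast
      then show "v \<in> {v \<in> verts G. u \<rightarrow>\<^bsub>G\<^esub> v}" using v P(3) uV by blast
    qed
    then have "d = n - card X"
      using deg[OF uV] sub[OF X] finite_subset[OF sub[OF X]] by (simp add: card_Diff_subset n_def)
    moreover have "card X \<le> n" unfolding n_def by (intro card_mono sub X) simp
    ultimately show ?thesis by simp
  qed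
  have "n = (\<Sum>X\<in>P. card X)"
    unfolding n_def partition_onD1[OF P(1)]
    using partition_onD2[OF P(1)] sub finite_subset[OF _ finite_verts]
    by (intro card_Union_disjoint) (auto simp: disjoint_def pairwise_def disjnt_def)
  also have "\<dots> = (\<Sum>X\<in>P. n - d)"
    using size by (intro sum.cong) force+
  finally have "n = k * (n - d)" using P(2) by simp
  \<comment> \<open>Ensures that the natural-number difference \<open>n - d\<close> is not
    truncated.\<close>
  moreover have "d \<le> n" using size P \<open>0 < k\<close> by (metis card.empty ex_in_conv le_add2 less_irrefl)
  ultimately have "real n = k * (real n - d)" by (metis of_nat_diff of_nat_mult)
  then have nd: "(1 - 1 / k) * n = d" using \<open>0 < k\<close> by (simp add: field_simps)
  have "adj.tot r = n * real d ^ (r - 1)" by (simp add: adj.tot_def walks n_def)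
  then have "(1 - 1 / k) * adj.tot r = ((1 - 1 / k) * n) * real d ^ (r - 1)" by simp
  also have "\<dots> = lambda1 G ^ r"
    unfolding nd lam using \<open>1 \<le> r\<close> by (cases r) auto
  finally show ?thesis by simp
qed

text \<open>Here \<open>lambda1 G = sqrt (p * q)\<close>. The total is
  \<open>2 * (p * q) ^ s\<close> for \<open>r = 2 * s\<close> and
  \<open>(p + q) * (p * q) ^ s\<close> for \<open>r = 2 * s + 1\<close>. Even \<open>r\<close> thus
  always gives equality, while odd \<open>r\<close> needs the equality case of AM-GM. The factor
  \<open>1 / 2\<close> is \<open>1 - 1 / \<omega>\<close> for \<open>\<omega> = 2\<close>.\<close>

lemma complete_bipartite_walks:
  assumes V: "verts G = U \<union> W" "U \<inter> W = {}" "U \<noteq> {}" "W \<noteq> {}"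
    and arcs: "arcs_ends G = U \<times> W \<union> W \<times> U" and r: "1 \<le> r"
  shows "lambda1 G ^ r = adj.tot r / 2 \<longleftrightarrow> even r \<or> card U = card W"
    and "regular G \<longleftrightarrow> card U = card W"
proof -
  have fin: "finite U" "finite W" using V(1) finite_verts by (metis finite_Un)+
  have inV: "v \<in> U \<Longrightarrow> v \<in> verts G" "v \<in> W \<Longrightarrow> v \<in> verts G" for v using V(1) by auto
  define p q where "p = real (card U)" and "q = real (card W)"
  have pq: "0 < p" "0 < q" using fin V by (auto simp: p_def q_def card_gt_0_iff)
  have nU: "{v \<in> verts G. u \<rightarrow>\<^bsub>G\<^esub> v} = W" if "u \<in> U" for u using that V arcs by blast
  have nW: "{v \<in> verts G. u \<rightarrow>\<^bsub>G\<^esub> v} = U" if "u \<in> W" for u using that V arcs by blast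
  have nbr: "adj.nbr x u = sum x {v \<in> verts G. u \<rightarrow>\<^bsub>G\<^esub> v}" for x u
    by (simp add: adj.nbr_def sum.If_cases Int_def)
  have nbrU: "adj.nbr x u = sum x W" if "u \<in> U" for u x by (simp only: nbr nU[OF that])
  have nbrW: "adj.nbr x u = sum x U" if "u \<in> W" for u x by (simp only: nbr nW[OF that])
  have lam: "lambda1 G = sqrt (p * q)"
  proof (rule lambda1_eqI)
    \<comment> \<open>The two values are balanced so that the equations on \<open>U\<close> and on
      \<open>W\<close> yield the same eigenvalue.\<close>
    let ?y = "\<lambda>v. if v \<in> U then sqrt q else sqrt p"
    show "verts G \<noteq> {}" using V by simp
    show "0 < ?y u" for u using pq by simp
    have "sum ?y U = p * sqrt q" by (simp add: p_def)
    moreover have "sum ?y W = (\<Sum>v\<in>W. sqrt p)" using V(2) by (intro sum.cong) auto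
    then have "sum ?y W = q * sqrt p" by (simp add: q_def)
    moreover have "sqrt p * sqrt p = p" "sqrt q * sqrt q = q" using pq by simp_all
    then have "q * sqrt p = sqrt (p * q) * sqrt q" "p * sqrt q = sqrt (p * q) * sqrt p"
      by (simp_all add: real_sqrt_mult mult_ac)
    moreover fix u assume "u \<in> verts G"
    ultimately show "adj.nbr ?y u = sqrt (p * q) * ?y u"
      using V nbrU[of u ?y] nbrW[of u ?y] by (cases "u \<in> U") auto
  qed
  \<comment> \<open>Two steps multiply the number of walks by \<open>p * q\<close>, whichever side
    they start from.\<close>
  have walks2: "adj.walks (2 * s) v = (p * q) ^ s" if "v \<in> verts G" for s v
    using that
  proof (induction s arbitrary: v)
    case (Suc s)
    have s1: "adj.walks (Suc (2 * s)) u = (p * q) ^ s * q" if "u \<in> U" for u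
      by (simp add: nbrU[OF that] Suc.IH inV q_def)
    have s2: "adj.walks (Suc (2 * s)) u = (p * q) ^ s * p" if "u \<in> W" for u
      by (simp add: nbrW[OF that] Suc.IH inV p_def)
    have "adj.walks (Suc (Suc (2 * s))) v = (p * q) ^ Suc s"
    proof (cases "v \<in> U")
      case True
      have "adj.walks (Suc (Suc (2 * s))) v = sum (adj.walks (Suc (2 * s))) W"
        unfolding adj.walks.simps(2)[of "Suc (2 * s)"] by (rule nbrU[OF True])
      then show ?thesis using s2 by (simp add: q_def del: adj.walks.simps)
    next
      case False
      then have v: "v \<in> W" using Suc.prems V by blast
      have "adj.walks (Suc (Suc (2 * s))) v = sum (adj.walks (Suc (2 * s))) U"
        unfolding adj.walks.simps(2)[of "Suc (2 * s)"] by (rule nbrW[OF v])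
      then show ?thesis using s1 by (simp add: p_def del: adj.walks.simps)
    qed
    then show ?case by simp
  qed simp
  have card: "real (card (verts G)) = p + q"
    using V fin by (simp add: card_Un_disjoint p_def q_def)
  have tot_odd: "adj.tot (Suc (2 * s)) = (p + q) * (p * q) ^ s" for s
    using walks2 by (simp add: adj.tot_def card)
  have tot_even: "adj.tot (2 * Suc s) = 2 * (p * q) ^ Suc s" for s
  proof -
    have "adj.tot (2 * Suc s) = (\<Sum>v\<in>verts G. adj.nbr (adj.walks (2 * s)) v)"
      by (simp add: adj.tot_def)
    also have "\<dots> = (\<Sum>v\<in>U. adj.nbr (adj.walks (2 * s)) v) + (\<Sum>v\<in>W. adj.nbr (adj.walks (2 * s)) v)"
      by (rule sum.union_disjoint[OF fin V(2), folded V(1)])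
    also have "\<dots> = p * (q * (p * q) ^ s) + q * (p * (p * q) ^ s)"
      by (simp add: nbrU nbrW walks2 inV p_def q_def)
    finally show ?thesis by simp
  qed
  show "lambda1 G ^ r = adj.tot r / 2 \<longleftrightarrow> even r \<or> card U = card W"
  proof (cases "even r")
    case True
    then obtain s where "r = 2 * Suc s" using r by (metis evenE mult_0_right not0_implies_Suc not_one_le_zero)
    then have "lambda1 G ^ r = adj.tot r / 2"
      using pq unfolding \<open>r = 2 * Suc s\<close> tot_even lam power_mult by simp
    then show ?thesis using True by simp
  next
    case False
    then obtain s where s: "r = Suc (2 * s)" by (metis oddE Suc_eq_plus1)
    have "lambda1 G ^ r = sqrt (p * q) * (p * q) ^ s"
      unfolding s lam power_Suc power_mult using pq by simp
    then have "lambda1 G ^ r = adj.tot r / 2 \<longleftrightarrow> sqrt (p * q) * (p * q) ^ s = (p + q) / 2 * (p * q) ^ s"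
      unfolding s tot_odd by simp
    also have "\<dots> \<longleftrightarrow> sqrt (p * q) = (p + q) / 2" using pq by simp
    also have "\<dots> \<longleftrightarrow> p = q"
    proof
      assume "sqrt (p * q) = (p + q) / 2"
      then have "(sqrt (p * q))\<^sup>2 = ((p + q) / 2)\<^sup>2" by (rule arg_cong)
      then have "p * q = ((p + q) / 2)\<^sup>2" using pq by simp
      then have "(p - q)\<^sup>2 = 0" by (simp add: power2_eq_square field_simps)
      then show "p = q" by simp
    qed (use pq in simp)
    finally show ?thesis using False by (simp add: p_def q_def)
  qed
  have degree: "out_degree G u = (if u \<in> U then card W else card U)" if "u \<in> verts G" for u
    using that V(1) nU[of u] nW[of u] by (auto simp only: out_degree_eq_card split: if_splits)
  show "regular G \<longleftrightarrow> card U = card W"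
  proof
    assume "regular G"
    then obtain d where d: "\<forall>v\<in>verts G. out_degree G v = d" by (auto simp: regular_def)
    obtain u w where uw: "u \<in> U" "w \<in> W" using V by blast
    then have "w \<notin> U" using V(2) by blast
    then show "card U = card W"
      using uw d degree[OF inV(1)[OF uw(1)]] degree[OF inV(2)[OF uw(2)]] inV by simp
  next
    assume "card U = card W"
    then show "regular G" unfolding regular_def by (simp add: degree)
  qed
qed

text \<open>The edge \<open>e\<close> guarantees a vertex other than \<open>v\<close>, and the first
  step of a path from \<open>v\<close> to it leads to a neighbour.\<close>

lemma connected_imp_neighbour:
  assumes "Digraph_Component.connected G" and e: "e \<in> arcs_ends G" and v: "v \<in> verts G"
  shows "\<exists>u\<in>verts G. v \<rightarrow>\<^bsub>G\<^esub> u"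
proof -
  have "strongly_connected G"
    using symmetric_connected_imp_strongly_connected[OF sym_arcs assms(1)] .
  obtain a b where ab: "a \<rightarrow>\<^bsub>G\<^esub> b" using e by (cases e) auto
  then obtain w where w: "w \<in> verts G" "w \<noteq> v"
    using adj_not_same adj_in_verts[OF ab] by metis
  have "v \<rightarrow>\<^sup>*\<^bsub>G\<^esub> w" using \<open>strongly_connected G\<close> v w by (auto simp: strongly_connected_def)
  then show ?thesis
    using w(2) by (cases rule: converse_reachable_cases) (auto intro: adj_in_verts)
qed

end

section \<open>The spectral bound and its equality cases\<close>

theorem theorem1p19:
  fixes G :: "('a, 'b) pre_digraph" and r :: nat
  assumes "Digraph.graph G" and "Digraph_Component.connected G" and "r \<ge> 1"
  shows "(lambda1 G ^ r \<le>
           (\<Sum>v\<in>verts G. real (num_walks G r v)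
              * sqrt (1 - 1 / real (clique_number_at G v))
              * sqrt (1 - 1 / real (clique_number G))))
       \<and> (lambda1 G ^ r =
           (\<Sum>v\<in>verts G. real (num_walks G r v)
              * sqrt (1 - 1 / real (clique_number_at G v))
              * sqrt (1 - 1 / real (clique_number G)))
         \<longleftrightarrow>
           (clique_number G > 2 \<longrightarrow>
              complete_multipartite (clique_number G) G \<and> regular G) \<and>
           (clique_number G = 2 \<longrightarrow>
              (\<exists>m n. complete_bipartite_digraph m n G) \<and> (odd r \<longrightarrow> regular G)))"
proof -
  interpret graph G by fact
  have ne: "verts G \<noteq> {}"
    using assms(2) symmetric_connected_imp_strongly_connected[OF sym_arcs]
    by (simp add: strongly_connected_def)
  define \<omega> where "\<omega> = clique_number G"
  define a where "a = 1 - 1 / real \<omega>"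
  define g where "g v = sqrt (1 - 1 / real (clique_number_at G v))" for v
  define R where "R = (\<Sum>v\<in>verts G. real (num_walks G r v)
              * sqrt (1 - 1 / real (clique_number_at G v))
              * sqrt (1 - 1 / real (clique_number G)))"
  have R: "R = sqrt a * (\<Sum>v\<in>verts G. g v * adj.walks (r - 1) v)"
    unfolding R_def sum_distrib_left
    using num_walks_eq_walks[of _ "r - 1"] \<open>r \<ge> 1\<close>
    by (intro sum.cong) (auto simp: a_def g_def \<omega>_def)
  obtain v1 where v1: "v1 \<in> verts G" using ne by blast
  have "1 \<le> \<omega>" using clique_number_at_bounds[OF v1] by (simp add: \<omega>_def)
  have "lambda1 G ^ r \<le> R \<and> (lambda1 G ^ r = R \<longleftrightarrow>
      (\<omega> > 2 \<longrightarrow> complete_multipartite \<omega> G \<and> regular G) \<and>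
      (\<omega> = 2 \<longrightarrow> (\<exists>m n. complete_bipartite_digraph m n G) \<and> (odd r \<longrightarrow> regular G)))"
  proof (cases "\<omega> = 1")
    \<comment> \<open>Without edges both sides are 0, as \<open>a = 0\<close> and
      \<open>r \<ge> 1\<close>; equality holds and both conditions on the right are vacuous.\<close>
    case True
    have "\<not> u \<rightarrow>\<^bsub>G\<^esub> v" for u v
    proof
      assume uv: "u \<rightarrow>\<^bsub>G\<^esub> v"
      then have "clique G {u, v}" "u \<noteq> v"
        using adj_in_verts[OF uv] adj.sym[OF uv] adj.irrefl uv by (auto simp: clique_def)
      then show False using card_clique_le[of "{u, v}"] True by (simp add: \<omega>_def)
    qed
    then have "adj.nbr (\<lambda>_. 1) u = 0 * 1" for u unfolding adj.nbr_def by simp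
    then have "lambda1 G = 0" by (intro lambda1_eqI[OF ne]) auto
    moreover have "R = 0" using True by (simp add: R a_def)
    ultimately show ?thesis using \<open>r \<ge> 1\<close> True by (simp add: power_0_left)
  next
    case False
    then have two: "2 \<le> \<omega>" using \<open>1 \<le> \<omega>\<close> by simp
    then have a: "0 < a" by (simp add: a_def)
    obtain S where S: "clique G S" "card S = \<omega>" unfolding \<omega>_def by (rule max_clique_exists)
    have "\<exists>e. e \<in> arcs_ends G"
    proof -
      obtain u v where "u \<in> S" "v \<in> S" "u \<noteq> v"
        using two S by (metis card_2_iff' ex_card subset_eq)
      then show ?thesis using S unfolding clique_def by blast
    qed
    then have deg: "\<exists>u\<in>verts G. v \<rightarrow>\<^bsub>G\<^esub> u" if "v \<in> verts G" for v
      using connected_imp_neighbour[OF assms(2) _ that] by blast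
    have g: "0 \<le> g v" if "v \<in> verts G" for v
      using clique_number_at_bounds(1)[OF that] by (simp add: g_def)
    have ms: "adj.adj_form y y \<le> a * (sum y (verts G))\<^sup>2"
      if "\<And>v. v \<in> verts G \<Longrightarrow> 0 \<le> y v" for y
      using motzkin_straus_clique_number[of y] two that by (simp add: a_def \<omega>_def)
    have msg: "adj.adj_form y y \<le> (\<Sum>v\<in>verts G. g v * y v)\<^sup>2"
      if "\<And>v. v \<in> verts G \<Longrightarrow> 0 \<le> y v" for y
      unfolding g_def by (rule motzkin_straus_clique_number_at[OF deg that])
    obtain x v0 where eig: "v0 \<in> verts G" "x v0 \<noteq> 0"
      "\<And>u. u \<in> verts G \<Longrightarrow> adj.nbr x u = lambda1 G * x u"
      using lambda1_eigenvector[OF ne] by blast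
    note bound = adj.weighted_eigenvalue_walk_bound[where g = g and a = a, OF eig a ms g msg \<open>r \<ge> 1\<close>,
        folded R]
    \<comment> \<open>Bounding the absolute value avoids settling the sign of
      \<open>lambda1 G\<close> first.\<close>
    have absle: "\<bar>lambda1 G\<bar> ^ r \<le> R" by (rule bound(1))
    then have le: "lambda1 G ^ r \<le> R" using power_abs[of "lambda1 G" r] by linarith
    have "R \<ge> 0" using absle by (meson order_trans zero_le_power abs_ge_zero)
    \<comment> \<open>Local clique numbers are at most \<open>\<omega>\<close>. For
      \<open>\<omega> > 2\<close> this closes the sandwich
      \<open>lambda1 G ^ r \<le> R \<le> a * adj.tot r\<close>, whose ends agree for regular
      complete multipartite graphs.\<close>
    have Rle: "R \<le> a * adj.tot r"
    proof -
      have "g v \<le> sqrt a" if "v \<in> verts G" for v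
        using clique_number_at_bounds[OF that]
        by (simp add: g_def a_def \<omega>_def frac_le)
      then have "R \<le> sqrt a * (\<Sum>v\<in>verts G. sqrt a * adj.walks (r - 1) v)"
        unfolding R using a adj.walks_nonneg
        by (intro mult_left_mono sum_mono mult_right_mono) auto
      also have "\<dots> = a * adj.tot r"
        using a by (simp add: adj.tot_def sum_distrib_left[symmetric] mult.assoc[symmetric])
      finally show ?thesis .
    qed
    have forward: "complete_multipartite \<omega> G \<and> (\<omega> > 2 \<longrightarrow> regular G)" if "lambda1 G ^ r = R"
    proof -
      have abs_eq: "\<bar>lambda1 G\<bar> ^ r = R" using that \<open>R \<ge> 0\<close> by (simp add: power_abs[symmetric])
      let ?X = "adj.walks (2 * r - 1)"
      have eq: "adj.adj_form ?X ?X = a * (sum ?X (verts G))\<^sup>2"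
        by (rule bound(2)) (use abs_eq in auto)
      have pos: "0 < adj.walks k v" if "v \<in> verts G" for k v
        by (rule adj.walks_pos[OF deg that])
      \<comment> \<open>Since no vertex is isolated, \<open>?X\<close> is positive everywhere, hence
        an interior maximiser.\<close>
      note str = adj.interior_maximizer_structure[where x = ?X, OF pos eq ms]
      have const: "adj.nbr ?X u = adj.nbr ?X v"
        if "u \<in> verts G" "v \<in> verts G" for u v
        by (rule str(1)) (use that in auto)
      have trans: "\<not> u \<rightarrow>\<^bsub>G\<^esub> w" if "u \<in> verts G" "v \<in> verts G" "w \<in> verts G"
        "\<not> u \<rightarrow>\<^bsub>G\<^esub> v" "\<not> v \<rightarrow>\<^bsub>G\<^esub> w" for u v w
        by (rule str(2)[of u v w]) (use that in auto)
      have "complete_multipartite \<omega> G"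
        unfolding \<omega>_def by (rule nonadjacent_trans_imp_complete_multipartite) (rule trans)
      moreover have "regular G" if "\<omega> > 2"
      proof -
        have K: "S \<subseteq> verts G" "pairwise (\<lambda>u v. u \<rightarrow>\<^bsub>G\<^esub> v) S" "3 \<le> card S"
          using S \<open>\<omega> > 2\<close> by (auto simp: clique_iff_pairwise)
        have part: "card (adj.part u) = card (adj.part v)" if "u \<in> verts G" "v \<in> verts G" for u v
          by (rule adj.equal_part_weights_imp_equal_parts[OF _ deg const K that])
            (use trans in blast)+
        have "out_degree G v = card (verts G) - card (adj.part v)" for v
        proof -
          have "{u \<in> verts G. v \<rightarrow>\<^bsub>G\<^esub> u} = verts G - adj.part v" by auto
          then show ?thesis by (simp add: out_degree_eq_card card_Diff_subset)
        qed
        then have "\<forall>v\<in>verts G. out_degree G v = card (verts G) - card (adj.part v1)"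
          using part[OF _ v1] by simp
        then show ?thesis unfolding regular_def by blast
      qed
      ultimately show ?thesis by blast
    qed
    show ?thesis
    proof (cases "\<omega> = 2")
      case True
      \<comment> \<open>Every vertex lies on an edge, so its local clique number is exactly 2 and
        \<open>R\<close> reduces to the unweighted count.\<close>
      have "g v = sqrt a" if "v \<in> verts G" for v
      proof -
        obtain u where u: "u \<in> verts G" "v \<rightarrow>\<^bsub>G\<^esub> u" using deg[OF \<open>v \<in> verts G\<close>] by blast
        then have "clique G {v, u}" "v \<noteq> u"
          using \<open>v \<in> verts G\<close> adj.sym adj.irrefl by (auto simp: clique_def)
        then have "2 \<le> clique_number_at G v" using card_clique_le_at[of "{v, u}" v] by simp
        then have "clique_number_at G v = \<omega>"
          using clique_number_at_bounds[OF \<open>v \<in> verts G\<close>] True by (simp add: \<omega>_def)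
        then show ?thesis by (simp add: g_def a_def)
      qed
      then have "R = sqrt a * (\<Sum>v\<in>verts G. sqrt a * adj.walks (r - 1) v)"
        unfolding R by simp
      also have "\<dots> = a * adj.tot r"
        using a by (simp add: adj.tot_def sum_distrib_left[symmetric] mult.assoc[symmetric])
      finally have Rtot: "R = adj.tot r / 2" using True by (simp add: a_def)
      have iff: "lambda1 G ^ r = R \<longleftrightarrow> even r \<or> regular G"
        if bip: "complete_bipartite_digraph m n G" for m n
      proof -
        obtain U W where UW: "verts G = U \<union> W" "U \<inter> W = {}" "arcs_ends G = U \<times> W \<union> W \<times> U"
          using bip unfolding complete_bipartite_digraph_def by blast
        moreover have "U \<noteq> {}" "W \<noteq> {}" using deg[OF v1] UW by auto
        ultimately show ?thesis
          unfolding Rtot using complete_bipartite_walks[of U W r] \<open>r \<ge> 1\<close> by blast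
      qed
      have "\<exists>m n. complete_bipartite_digraph m n G" if "lambda1 G ^ r = R"
        using forward[OF that] complete_multipartite_2_imp_bipartite True by simp
      then have "lambda1 G ^ r = R \<longleftrightarrow>
          (\<exists>m n. complete_bipartite_digraph m n G) \<and> (odd r \<longrightarrow> regular G)"
        using iff by blast
      then show ?thesis using le True by simp
    next
      case False
      then have three: "\<omega> > 2" using two by simp
      have "lambda1 G ^ r = R" if "complete_multipartite \<omega> G" "regular G"
        using regular_multipartite_walks[OF ne that _ \<open>r \<ge> 1\<close>] two le Rle by (simp add: a_def)
      then show ?thesis using le forward three by auto
    qed
  qed
  then show ?thesis unfolding R_def \<omega>_def .
qed

end
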